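(* For every fixed $k$, STAR $k$-COLORING is in $\mathsf{NP}$ when the input is restricted to $\{W_4, \text{dart}, \text{gem}\}$-free graphs.
   Context: All graphs are finite and simple. A star of $G$ is a set $W\subseteq V(G)$ with $G[W]\cong K_{1,m}$ ($m\ge1$); a maximal star is a star not properly contained in another star. A $k$-coloring is a map $\rho:V(G)\to\{1,\dots,k\}$; a set $W$ is monochromatic if $|\rho(W)|=1$. A star $k$-coloring has no monochromatic maximal star. STAR $k$-COLORING: given a connected graph $G$, decide whether $G$ admits a star $k$-coloring. The diamond is $K_4$ minus an edge; $W_4$ is the 4-cycle plus a vertex adjacent to all four cycle vertices; the gem is the path $P_4$ plus a vertex adjacent to all its vertices; the dart is a diamond plus an extra vertex adjacent only to one of the two degree-3 vertices of the diamond. $\{W_4,\text{dart},\text{gem}\}$-free means no induced subgraph isomorphic to any of them. *)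

theory Defs
  imports
    "Graph_Theory.Graph_Theory"
    "HOL-Computational_Algebra.Polynomial"
begin

section \<open>Deterministic multi-tape Turing machines\<close>

text \<open>
  States and tape symbols are initial segments of the naturals. Symbol 0 is the blank, 1 and 2 are
  the input bits; a machine may use further work symbols. Tapes are infinite in both directions.
\<close>

datatype head_move = Move_Left | Stay | Move_Right

record turing_machine =
  num_tapes :: nat
  num_symbols :: nat
  num_states :: nat
  start_state :: nat
  accept_state :: nat
  reject_state :: nat
  transition :: "nat \<Rightarrow> nat list \<Rightarrow> nat \<times> (nat \<times> head_move) list"

definition wf_tm :: "turing_machine \<Rightarrow> bool" where
  "wf_tm M \<longleftrightarrow>
     num_tapes M \<ge> 1 \<and> num_symbols M \<ge> 3 \<and>
     start_state M < num_states M \<and> accept_state M < num_states M \<and> reject_state M < num_states M \<and>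
     accept_state M \<noteq> reject_state M \<and>
     (\<forall>q < num_states M. \<forall>s. length s = num_tapes M \<and> set s \<subseteq> {..<num_symbols M} \<longrightarrow>
        (case transition M q s of (q', acts) \<Rightarrow>
           q' < num_states M \<and> length acts = num_tapes M \<and> fst ` set acts \<subseteq> {..<num_symbols M}))"

text \<open>A tape is its contents together with the position of the head.\<close>

type_synonym tape = "(int \<Rightarrow> nat) \<times> int"
type_synonym tm_config = "nat \<times> tape list"

fun tape_read :: "tape \<Rightarrow> nat" where
  "tape_read (t, p) = t p"

fun move_head :: "head_move \<Rightarrow> int \<Rightarrow> int" where
  "move_head Move_Left p = p - 1"
| "move_head Stay p = p"
| "move_head Move_Right p = p + 1"

fun tape_act :: "nat \<times> head_move \<Rightarrow> tape \<Rightarrow> tape" where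
  "tape_act (s, d) (t, p) = (t(p := s), move_head d p)"

fun tm_step :: "turing_machine \<Rightarrow> tm_config \<Rightarrow> tm_config" where
  "tm_step M (q, ts) =
     (if q = accept_state M \<or> q = reject_state M then (q, ts)
      else case transition M q (map tape_read ts) of (q', acts) \<Rightarrow> (q', map2 tape_act acts ts))"

definition bit_symbol :: "bool \<Rightarrow> nat" where
  "bit_symbol b = (if b then 2 else 1)"

definition blank_tape :: tape where
  "blank_tape = (\<lambda>_. 0, 0)"

definition input_tape :: "bool list \<Rightarrow> tape" where
  "input_tape w = (\<lambda>i. if 0 \<le> i \<and> i < int (length w) then bit_symbol (w ! nat i) else 0, 0)"

definition tm_init :: "turing_machine \<Rightarrow> bool list \<Rightarrow> tm_config" where
  "tm_init M w = (start_state M, input_tape w # replicate (num_tapes M - 1) blank_tape)"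

definition tm_decides_in_time :: "turing_machine \<Rightarrow> bool list set \<Rightarrow> (nat \<Rightarrow> nat) \<Rightarrow> bool" where
  "tm_decides_in_time M L T \<longleftrightarrow>
     (\<forall>w. \<exists>t \<le> T (length w).
        fst ((tm_step M ^^ t) (tm_init M w)) = (if w \<in> L then accept_state M else reject_state M))"

section \<open>The classes P and NP\<close>

definition class_P :: "bool list set set" where
  "class_P = {L. \<exists>M (p :: nat poly). wf_tm M \<and> tm_decides_in_time M L (poly p)}"

text \<open>Self-delimiting pairing: the bits of the first word are doubled and 01 is the separator.\<close>

definition word_pair :: "bool list \<Rightarrow> bool list \<Rightarrow> bool list" where
  "word_pair x u = concat (map (\<lambda>b. [b, b]) x) @ [False, True] @ u"

definition class_NP :: "bool list set set" where
  "class_NP = {L. \<exists>V \<in> class_P. \<exists>p :: nat poly.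
     \<forall>x. x \<in> L \<longleftrightarrow> (\<exists>u. length u \<le> poly p (length x) \<and> word_pair x u \<in> V)}"

section \<open>Star colorings\<close>

text \<open>
  As in the graph library, an undirected graph is a symmetric digraph; finite simple graphs are
  those satisfying \<^const>\<open>graph\<close>, or \<^const>\<open>pair_graph\<close> when arcs are pairs of vertices.
\<close>

definition is_star :: "('a, 'b) pre_digraph \<Rightarrow> 'a set \<Rightarrow> bool" where
  "is_star G W \<longleftrightarrow> W \<subseteq> verts G \<and> (\<exists>m \<ge> 1. complete_bipartite_digraph 1 m (G \<restriction> W))"

definition is_maximal_star :: "('a, 'b) pre_digraph \<Rightarrow> 'a set \<Rightarrow> bool" where
  "is_maximal_star G W \<longleftrightarrow> is_star G W \<and> (\<nexists>W'. is_star G W' \<and> W \<subset> W')"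

definition is_coloring :: "nat \<Rightarrow> ('a, 'b) pre_digraph \<Rightarrow> ('a \<Rightarrow> nat) \<Rightarrow> bool" where
  "is_coloring k G \<rho> \<longleftrightarrow> \<rho> ` verts G \<subseteq> {1..k}"

definition monochromatic :: "('a \<Rightarrow> nat) \<Rightarrow> 'a set \<Rightarrow> bool" where
  "monochromatic \<rho> W \<longleftrightarrow> card (\<rho> ` W) = 1"

definition is_star_coloring :: "nat \<Rightarrow> ('a, 'b) pre_digraph \<Rightarrow> ('a \<Rightarrow> nat) \<Rightarrow> bool" where
  "is_star_coloring k G \<rho> \<longleftrightarrow>
     is_coloring k G \<rho> \<and> (\<nexists>W. is_maximal_star G W \<and> monochromatic \<rho> W)"

section \<open>Forbidden induced subgraphs\<close>

definition undirected :: "'a set \<Rightarrow> 'a rel \<Rightarrow> 'a pair_pre_digraph" where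
  "undirected V E = \<lparr> pverts = V, parcs = E \<union> E\<inverse> \<rparr>"

definition W4_graph :: "nat pair_pre_digraph" where
  "W4_graph = undirected {0,1,2,3,4}
     {(0,1), (1,2), (2,3), (3,0), (4,0), (4,1), (4,2), (4,3)}"

text \<open>The diamond on 0, 1, 2, 3 lacks the edge 23; its degree-3 vertices are 0 and 1.\<close>

definition dart_graph :: "nat pair_pre_digraph" where
  "dart_graph = undirected {0,1,2,3,4}
     {(0,1), (0,2), (0,3), (1,2), (1,3), (4,0)}"

definition gem_graph :: "nat pair_pre_digraph" where
  "gem_graph = undirected {0,1,2,3,4}
     {(0,1), (1,2), (2,3), (4,0), (4,1), (4,2), (4,3)}"

definition induced_free :: "('c, 'd) pre_digraph \<Rightarrow> ('a, 'b) pre_digraph \<Rightarrow> bool" where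
  "induced_free H G \<longleftrightarrow> (\<nexists>W. W \<subseteq> verts G \<and> digraph_iso (G \<restriction> W) H)"

definition W4_dart_gem_free :: "('a, 'b) pre_digraph \<Rightarrow> bool" where
  "W4_dart_gem_free G \<longleftrightarrow>
     induced_free (with_proj W4_graph) G \<and>
     induced_free (with_proj dart_graph) G \<and>
     induced_free (with_proj gem_graph) G"

section \<open>The decision problem\<close>

text \<open>
  An input graph has vertices \<open>0, \<dots>, n - 1\<close> and is presented by its \<open>n \<times> n\<close> adjacency matrix,
  row by row.
\<close>

definition adjacency_code :: "nat pair_pre_digraph \<Rightarrow> bool list" where
  "adjacency_code G =
     (let n = card (pverts G) in map (\<lambda>e. e \<in> parcs G) (List.product [0..<n] [0..<n]))"

text \<open>
  The language of yes-instances of \<open>STAR k-COLORING\<close> with inputs restricted to the graph class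
  \<open>C\<close>. The name \<open>connected\<close> is qualified because of its topological namesake.
\<close>

definition STAR_COLORING ::
    "nat \<Rightarrow> ((nat, nat \<times> nat) pre_digraph \<Rightarrow> bool) \<Rightarrow> bool list set" where
  "STAR_COLORING k C = {adjacency_code G | G.
     pair_graph G \<and> (\<exists>n. pverts G = {..<n}) \<and> Digraph_Component.connected (with_proj G) \<and>
     C (with_proj G) \<and> (\<exists>\<rho>. is_star_coloring k (with_proj G) \<rho>)}"

end

theory Submission
  imports Defs
begin

text \<open>
  In a graph without induced \<open>W\<^sub>4\<close>, dart and gem, the neighbourhood of a vertex \<open>v\<close> is a clique
  joined to a disjoint union of cliques. A star with centre \<open>v\<close> and at least two leaves is maximal
  iff its leaves form a transversal of the disjoint cliques, so although there may be exponentially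
  many maximal stars, a monochromatic one with centre \<open>v\<close> exists iff each of these cliques contains
  a vertex of the colour of \<open>v\<close>. Maximal stars on two vertices are pairs of adjacent twins.
  Being a star colouring is therefore a first-order property of the graph and the colour classes,
  and so is the absence of the forbidden subgraphs; connectedness becomes first-order once a strict
  order of the vertices, in which all but one have a smaller neighbour, is guessed as well. The
  certificate consists of the colour classes and this order. Finally, first-order properties of a
  word with arithmetic on positions and bounded quantifiers are decidable in polynomial time: nested
  loops over counters, each counter being a head on a copy of the input.
\<close>

section \<open>Counter programs\<close>

text \<open>In general graphs a colouring alone is a poor certificate: excluding a monochromatic
  maximal star means ranging over sets of leaves. The forbidden subgraphs make "equal or adjacent"
  transitive on the relevant neighbours of a centre, so a set of leaves can be grown greedily and
  only the presence of single vertices has to be tested. The second obstacle is that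
  \<open>class_P\<close> is defined by concrete machines with a polynomial clock. The verifier is
  therefore written as a formula and compiled by one general theorem. Registers are unary head
  positions, so their values stay polynomial. A formula has a fixed number of quantifiers over
  numbers and cannot follow paths of unbounded length; this is why an order witnessing connectedness
  is part of the certificate. The colour classes of a certificate may overlap. The star condition is
  monotone in the relation "same colour", so any choice among the listed colours of a vertex is
  good.\<close>

text \<open>
  A program manipulates registers holding natural numbers and can inspect, for a register with
  value \<open>v > 0\<close>, the bit number \<open>v - 1\<close> of the input word. On a Turing machine register \<open>i\<close> is the
  position (plus one) of the head on tape \<open>i\<close>, which holds a copy of the input behind the marker 3.
\<close>

datatype com =
    Skip
  | Inc nat
  | Dec nat
  | Seq com com
  | If_Sym nat nat com com
  | While_Not nat nat com

definition read_symbol :: "bool list \<Rightarrow> nat \<Rightarrow> nat" where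
  "read_symbol w v = (if v = 0 then 3 else if v \<le> length w then bit_symbol (w ! (v - 1)) else 0)"

text \<open>A step sees the registers only through the symbols under the heads and moves at most one
  head, so it can be used verbatim as a machine transition. A step without movement names register 0
  with \<open>Stay\<close>.\<close>

fun com_next :: "com \<Rightarrow> (nat \<Rightarrow> nat) \<Rightarrow> com \<times> nat \<times> head_move" where
  "com_next Skip \<sigma> = (Skip, 0, Stay)"
| "com_next (Inc i) \<sigma> = (Skip, i, Move_Right)"
| "com_next (Dec i) \<sigma> = (Skip, i, if \<sigma> i = 3 then Stay else Move_Left)"
| "com_next (Seq c1 c2) \<sigma> =
     (if c1 = Skip then (c2, 0, Stay) else case com_next c1 \<sigma> of (c, m) \<Rightarrow> (Seq c c2, m))"
| "com_next (If_Sym i a c1 c2) \<sigma> = (if \<sigma> i = a then c1 else c2, 0, Stay)"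
| "com_next (While_Not i a c) \<sigma> = (if \<sigma> i = a then Skip else Seq c (While_Not i a c), 0, Stay)"

fun counter_move :: "head_move \<Rightarrow> nat \<Rightarrow> nat" where
  "counter_move Move_Left v = v - 1"
| "counter_move Stay v = v"
| "counter_move Move_Right v = Suc v"

fun com_step :: "bool list \<Rightarrow> com \<times> (nat \<Rightarrow> nat) \<Rightarrow> com \<times> (nat \<Rightarrow> nat)" where
  "com_step w (c, s) = (case com_next c (\<lambda>i. read_symbol w (s i)) of (c', i, d) \<Rightarrow>
     (c', s(i := counter_move d (s i))))"

text \<open>\<open>Skip\<close> is a fixed point of \<open>com_step\<close>, so \<open>t\<close> is
  an upper bound on the number of steps, not their exact number.\<close>

definition runs :: "bool list \<Rightarrow> com \<Rightarrow> (nat \<Rightarrow> nat) \<Rightarrow> nat \<Rightarrow> (nat \<Rightarrow> nat) \<Rightarrow> bool" where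
  "runs w c s t s' \<longleftrightarrow> (com_step w ^^ t) (c, s) = (Skip, s')"

lemma read_symbol_eq_3 [simp]: "read_symbol w v = 3 \<longleftrightarrow> v = 0"
  by (auto simp: read_symbol_def bit_symbol_def)

lemma read_symbol_eq_0: "read_symbol w v = 0 \<longleftrightarrow> length w < v"
  by (auto simp: read_symbol_def bit_symbol_def)

lemma read_symbol_eq_2: "read_symbol w (Suc v) = 2 \<longleftrightarrow> v < length w \<and> w ! v"
  by (auto simp: read_symbol_def bit_symbol_def)

section \<open>Rules for composing runs with step bounds\<close>

lemma funpow_com_step_Skip [simp]: "(com_step w ^^ t) (Skip, s) = (Skip, s)"
  by (induction t) auto

lemma runs_mono:
  assumes "runs w c s t s'" "t \<le> t'"
  shows "runs w c s t' s'"
proof -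
  have "(com_step w ^^ t') (c, s) = (com_step w ^^ (t' - t)) ((com_step w ^^ t) (c, s))"
    using assms(2) by (metis comp_apply funpow_add le_add_diff_inverse2)
  then show ?thesis
    using assms(1) by (simp add: runs_def)
qed

lemma runs_Suc: "runs w c s (Suc t) s' \<longleftrightarrow> (case com_step w (c, s) of (c', s1) \<Rightarrow> runs w c' s1 t s')"
  by (simp add: runs_def funpow_Suc_right del: funpow.simps com_step.simps split: prod.split)

lemma runs_Skip [simp]: "runs w Skip s t s' \<longleftrightarrow> s' = s"
  by (auto simp: runs_def)

lemma runs_Inc: "runs w (Inc i) s 1 (s(i := Suc (s i)))"
  by (simp add: runs_Suc)

lemma runs_Dec: "runs w (Dec i) s 1 (s(i := s i - 1))"
  by (simp add: runs_Suc fun_eq_iff)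

lemma runs_Seq:
  assumes "runs w c1 s t1 s1" "runs w c2 s1 t2 s2"
  shows "runs w (Seq c1 c2) s (t1 + t2 + 1) s2"
  using assms
proof (induction t1 arbitrary: c1 s)
  case 0
  then have "c1 = Skip" "s1 = s" by (auto simp: runs_def)
  then have "runs w c2 s t2 s2" using "0.prems" by blast
  then show ?case using \<open>c1 = Skip\<close> by (simp add: runs_Suc)
next
  case (Suc t)
  show ?case
  proof (cases "c1 = Skip")
    case True
    then have "s1 = s" using Suc.prems(1) by simp
    then have "runs w c2 s t2 s2" using Suc.prems(2) by blast
    then have "runs w (Seq c1 c2) s (Suc t2) s2"
      using True by (simp add: runs_Suc)
    then show ?thesis by (rule runs_mono) simp
  next
    case False
    obtain c' i d where n: "com_next c1 (\<lambda>i. read_symbol w (s i)) = (c', i, d)"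
      by (metis prod_cases3)
    let ?s' = "s(i := counter_move d (s i))"
    have "runs w c' ?s' t s1"
      using Suc.prems(1) n by (simp add: runs_Suc)
    then have "runs w (Seq c' c2) ?s' (t + t2 + 1) s2"
      using Suc.IH Suc.prems(2) by blast
    then show ?thesis
      using False n runs_Suc[of w "Seq c1 c2" s "t + t2 + 1"] by simp
  qed
qed

lemma runs_If:
  assumes "read_symbol w (s i) = a \<Longrightarrow> runs w c1 s t s'" "read_symbol w (s i) \<noteq> a \<Longrightarrow> runs w c2 s t s'"
  shows "runs w (If_Sym i a c1 c2) s (t + 1) s'"
  using assms by (auto simp: runs_Suc)

text \<open>\<open>S j\<close> is the whole register state after \<open>j\<close> rounds, so the
  invariant is an explicit trajectory. Unfolding the loop and dropping the finished body add one
  step each to a round; the last test costs 1.\<close>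

lemma runs_While:
  assumes "\<And>j. j < n \<Longrightarrow> read_symbol w (S j r) \<noteq> a"
    and "\<And>j. j < n \<Longrightarrow> runs w c (S j) b (S (Suc j))"
    and "read_symbol w (S n r) = a"
  shows "runs w (While_Not r a c) (S 0) (n * (b + 2) + 1) (S n)"
  using assms
proof (induction n arbitrary: S)
  case 0
  then show ?case by (simp add: runs_Suc)
next
  case (Suc n)
  have "runs w (While_Not r a c) (S (Suc 0)) (n * (b + 2) + 1) (S (Suc n))"
    using Suc.IH[of "\<lambda>j. S (Suc j)"] Suc.prems by simp
  then have "runs w (Seq c (While_Not r a c)) (S 0) (b + (n * (b + 2) + 1) + 1) (S (Suc n))"
    using Suc.prems(2)[of 0] by (intro runs_Seq) auto
  then have "runs w (While_Not r a c) (S 0) (Suc (b + (n * (b + 2) + 1) + 1)) (S (Suc n))"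
    using Suc.prems(1)[of 0] by (simp add: runs_Suc)
  then show ?case by (rule runs_mono) simp
qed

subsection \<open>Simulation by a Turing machine\<close>

text \<open>The finitely many programs that remain during an execution serve as states of the machine.\<close>

fun residuals :: "com \<Rightarrow> com set" where
  "residuals Skip = {Skip}"
| "residuals (Inc i) = {Inc i, Skip}"
| "residuals (Dec i) = {Dec i, Skip}"
| "residuals (Seq c1 c2) = (\<lambda>c. Seq c c2) ` residuals c1 \<union> residuals c2"
| "residuals (If_Sym i a c1 c2) = {If_Sym i a c1 c2} \<union> residuals c1 \<union> residuals c2"
| "residuals (While_Not i a c) =
     {While_Not i a c, Skip} \<union> (\<lambda>c'. Seq c' (While_Not i a c)) ` residuals c"

fun num_regs :: "com \<Rightarrow> nat" where
  "num_regs Skip = 1"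
| "num_regs (Inc i) = Suc i"
| "num_regs (Dec i) = Suc i"
| "num_regs (Seq c1 c2) = max (num_regs c1) (num_regs c2)"
| "num_regs (If_Sym i a c1 c2) = max (Suc i) (max (num_regs c1) (num_regs c2))"
| "num_regs (While_Not i a c) = max (Suc i) (num_regs c)"

lemma finite_residuals: "finite (residuals c)"
  by (induction c) auto

lemma self_in_residuals: "c \<in> residuals c"
  by (induction c) auto

lemma Skip_in_residuals: "Skip \<in> residuals c"
  by (induction c) auto

text \<open>A loop unfolds to its body followed by the same loop, so iterating leads back to
  programs already collected.\<close>

lemma residuals_closed: "c' \<in> residuals c \<Longrightarrow> fst (com_next c' \<sigma>) \<in> residuals c"
proof (induction c arbitrary: c')
  case (Seq c1 c2)
  show ?case
  proof (cases "c' \<in> residuals c2")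
    case True
    then show ?thesis using Seq.IH(2) by auto
  next
    case False
    then obtain d where "d \<in> residuals c1" "c' = Seq d c2" using Seq.prems by auto
    then show ?thesis using Seq.IH(1)[of d] by (auto simp: self_in_residuals split: prod.split)
  qed
next
  case (If_Sym i a c1 c2)
  then show ?case by (auto simp: self_in_residuals)
next
  case (While_Not i a c)
  show ?case
  proof (cases "c' = While_Not i a c \<or> c' = Skip")
    case True
    then show ?thesis using self_in_residuals[of c] by (cases "\<sigma> i = a") auto
  next
    case False
    then obtain d where "d \<in> residuals c" "c' = Seq d (While_Not i a c)"
      using While_Not.prems by auto
    then show ?thesis using While_Not.IH[of d] by (auto split: prod.split)
  qed
qed auto

lemma num_regs_pos: "num_regs c > 0"
  by (induction c) auto

lemma num_regs_residuals: "c' \<in> residuals c \<Longrightarrow> num_regs c' \<le> num_regs c"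
  by (induction c arbitrary: c') (fastforce simp: Suc_le_eq num_regs_pos max_def)+

lemma com_next_cong:
  "(\<And>i. i < num_regs c \<Longrightarrow> \<sigma> i = \<tau> i) \<Longrightarrow> com_next c \<sigma> = com_next c \<tau>"
  by (induction c) (auto split: prod.split)

lemma com_next_reg: "com_next c \<sigma> = (c', i, d) \<Longrightarrow> i < num_regs c"
  by (induction c arbitrary: c')
     (auto simp: num_regs_pos less_max_iff_disj split: if_splits prod.splits)

text \<open>No head passes the marker 3. This reconciles truncated subtraction on registers with
  tapes that are infinite to the left.\<close>

lemma com_next_Left: "com_next c \<sigma> = (c', i, Move_Left) \<Longrightarrow> \<sigma> i \<noteq> 3"
  by (induction c arbitrary: c') (auto split: if_splits prod.splits)

section \<open>Heads as registers, and the machine of a program\<close>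

definition program_tape :: "bool list \<Rightarrow> nat \<Rightarrow> tape" where
  "program_tape w v = ((fst (input_tape w))(-1 := 3), int v - 1)"

lemma tape_read_program_tape [simp]: "tape_read (program_tape w v) = read_symbol w v"
  by (auto simp: program_tape_def input_tape_def read_symbol_def nat_diff_distrib)

lemma tape_act_program_tape:
  "(d = Move_Left \<Longrightarrow> v \<noteq> 0) \<Longrightarrow>
   tape_act (read_symbol w v, d) (program_tape w v) = program_tape w (counter_move d v)"
  using tape_read_program_tape[of w v]
  by (cases d) (auto simp: program_tape_def fun_eq_iff simp del: tape_read_program_tape)

text \<open>State 0 copies the input to all tapes, state 1 rewinds them and writes the marker.\<close>

definition program_machine :: "nat \<Rightarrow> nat \<Rightarrow> (com \<Rightarrow> nat) \<Rightarrow> (nat \<Rightarrow> com) \<Rightarrow> com \<Rightarrow> turing_machine" where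
  "program_machine R m enc dec c = \<lparr>
     num_tapes = R, num_symbols = 4, num_states = m + 4,
     start_state = 0, accept_state = 2, reject_state = 3,
     transition = (\<lambda>q ss.
       if q = 0 then
         (if ss ! 0 = 0 then (1, map (\<lambda>a. (a, Move_Left)) ss)
          else (0, map (\<lambda>a. (ss ! 0, Move_Right)) ss))
       else if q = 1 then
         (if ss ! 0 = 0 then (enc c + 4, map (\<lambda>a. (3, Stay)) ss)
          else (1, map (\<lambda>a. (a, Move_Left)) ss))
       else if q < 4 then (q, map (\<lambda>a. (a, Stay)) ss)
       else if dec (q - 4) = Skip then
         (if ss ! 1 = 3 then 3 else 2, map (\<lambda>a. (a, Stay)) ss)
       else (case com_next (dec (q - 4)) (\<lambda>j. ss ! j) of (c', i, d) \<Rightarrow>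
         (enc c' + 4, map (\<lambda>j. (ss ! j, if j = i then d else Stay)) [0..<length ss]))) \<rparr>"

text \<open>\<open>enc\<close> and \<open>dec\<close> number the residual programs below
  \<open>m\<close>; their states are shifted by 4 behind those for copying, rewinding, accepting and
  rejecting. At least two tapes are required because the verdict is read off register 1.\<close>

locale program_simulation =
  fixes R m :: nat and enc :: "com \<Rightarrow> nat" and dec :: "nat \<Rightarrow> com" and c0 :: com
  assumes R2: "2 \<le> R" and Rc: "num_regs c0 \<le> R"
    and dec: "\<And>q. q < m \<Longrightarrow> dec q \<in> residuals c0"
    and enc: "\<And>c. c \<in> residuals c0 \<Longrightarrow> enc c < m \<and> dec (enc c) = c"
begin

abbreviation M where "M \<equiv> program_machine R m enc dec c0"

lemma wf_M: "wf_tm M"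
proof -
  have "case transition M q ss of (q', acts) \<Rightarrow>
      q' < m + 4 \<and> length acts = R \<and> fst ` set acts \<subseteq> {..<4}"
    if q: "q < m + 4" and ss: "length ss = R" "set ss \<subseteq> {..<4}" for q ss
  proof -
    have nth: "ss ! j < 4" if "j < R" for j
      using ss that nth_mem by blast
    have "enc c0 < m"
      using enc self_in_residuals by blast
    moreover have "m > 0"
      using \<open>enc c0 < m\<close> by simp
    moreover have "enc c' < m" if "\<not> q < 4" "com_next (dec (q - 4)) \<sigma> = (c', i, d)" for \<sigma> c' i d
      using enc residuals_closed[of "dec (q - 4)" c0 \<sigma>] dec[of "q - 4"] that q by fastforce
    moreover have "ss ! 0 < 4" using nth R2 by simp
    ultimately show ?thesis
      using q ss nth
      by (cases "com_next (dec (q - 4)) (\<lambda>j. ss ! j)")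
         (auto simp: program_machine_def image_subset_iff split: if_splits)
  qed
  then show ?thesis
    using R2 by (auto simp: wf_tm_def program_machine_def)
qed

section \<open>Set-up phase: copying the input and rewinding\<close>

definition copy_config :: "bool list \<Rightarrow> nat \<Rightarrow> tm_config" where
  "copy_config w p = (0, (fst (input_tape w), int p) #
     replicate (R - 1) (fst (input_tape (take p w)), int p))"

lemma copy_config_0: "copy_config w 0 = tm_init M w"
  by (auto simp: copy_config_def tm_init_def program_machine_def input_tape_def blank_tape_def)

lemma R_split: "R = Suc (R - 1)"
  using R2 by simp

lemma input_tape_upd:
  assumes "p < length w"
  shows "(fst (input_tape (take p w)))(int p := bit_symbol (w ! p)) = fst (input_tape (take (Suc p) w))"
proof
  fix i :: int
  have "nat i < p \<or> nat i = p \<or> p < nat i" by linarith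
  then show "((fst (input_tape (take p w)))(int p := bit_symbol (w ! p))) i =
      fst (input_tape (take (Suc p) w)) i"
    using assms by (auto simp: input_tape_def)
qed

lemma copy_step:
  assumes "p < length w"
  shows "tm_step M (copy_config w p) = copy_config w (Suc p)"
proof -
  have [simp]: "fst (input_tape w) (int p) = bit_symbol (w ! p)"
    using assms by (simp add: input_tape_def)
  have [simp]: "bit_symbol b \<noteq> 0" for b by (simp add: bit_symbol_def)
  have u: "(fst (input_tape w))(int p := bit_symbol (w ! p)) = fst (input_tape w)"
    by (rule ext) simp
  show ?thesis
    by (simp add: copy_config_def program_machine_def zip_replicate map_replicate input_tape_upd[OF assms] u)
qed

lemma copy_steps: "p \<le> length w \<Longrightarrow> (tm_step M ^^ p) (tm_init M w) = copy_config w p"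
  by (induction p) (simp_all add: copy_config_0 copy_step)

text \<open>Bits are coded by nonblank symbols, so the first blank on the way back is the cell
  before the input. It is reached at \<open>p = 0\<close> and receives the marker.\<close>

definition rewind_config :: "bool list \<Rightarrow> nat \<Rightarrow> tm_config" where
  "rewind_config w p = (1, replicate R (fst (input_tape w), int p - 1))"

lemma copy_config_end: "copy_config w (length w) = (0, replicate R (fst (input_tape w), int (length w)))"
  using R_split by (metis copy_config_def order_refl replicate_Suc take_all)

lemma rewind_start: "tm_step M (copy_config w (length w)) = rewind_config w (length w)"
proof -
  have [simp]: "replicate R x ! 0 = x" for x :: nat
    using R2 by simp
  have [simp]: "fst (input_tape w) (int (length w)) = 0"
    by (simp add: input_tape_def)
  have u: "(fst (input_tape w))(int (length w) := 0) = fst (input_tape w)"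
    by (rule ext) simp
  show ?thesis
    by (simp add: copy_config_end rewind_config_def program_machine_def zip_replicate map_replicate u)
qed

lemma rewind_step:
  assumes "Suc p \<le> length w"
  shows "tm_step M (rewind_config w (Suc p)) = rewind_config w p"
proof -
  have [simp]: "replicate R x ! 0 = x" for x :: nat
    using R2 by simp
  have r: "fst (input_tape w) (int p) = bit_symbol (w ! p)"
    using assms by (simp add: input_tape_def)
  have [simp]: "bit_symbol b \<noteq> 0" for b by (simp add: bit_symbol_def)
  have u: "(fst (input_tape w))(int p := bit_symbol (w ! p)) = fst (input_tape w)"
    by (rule ext) (simp add: r)
  show ?thesis
    by (simp add: rewind_config_def program_machine_def zip_replicate map_replicate u r)
qed

lemma rewind_steps: "p \<le> length w \<Longrightarrow> (tm_step M ^^ p) (rewind_config w p) = rewind_config w 0"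
  by (induction p) (simp_all add: funpow_Suc_right rewind_step del: funpow.simps)

section \<open>Step-by-step simulation and verdict\<close>

definition program_config :: "bool list \<Rightarrow> com \<Rightarrow> (nat \<Rightarrow> nat) \<Rightarrow> tm_config" where
  "program_config w c s = (enc c + 4, map (\<lambda>i. program_tape w (s i)) [0..<R])"

lemma program_start: "tm_step M (rewind_config w 0) = program_config w c0 (\<lambda>_. 0)"
proof -
  have [simp]: "replicate R x ! 0 = x" for x :: nat
    using R2 by simp
  have [simp]: "fst (input_tape w) (-1) = 0"
    by (simp add: input_tape_def)
  show ?thesis
    by (simp add: rewind_config_def program_config_def program_machine_def zip_replicate
        map_replicate program_tape_def map_replicate_trivial)
qed

text \<open>Copying and rewinding take \<open>length w\<close> steps each; turning round and writing
  the marker take one each.\<close>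

lemma setup_steps:
  "(tm_step M ^^ (2 * length w + 2)) (tm_init M w) = program_config w c0 (\<lambda>_. 0)"
proof -
  have "2 * length w + 2 = Suc (length w + Suc (length w))" by simp
  then show ?thesis
    by (simp only: funpow_add funpow.simps comp_apply copy_steps rewind_start rewind_steps
        program_start order_refl)
qed

lemma program_step:
  assumes c: "c \<in> residuals c0" and "c \<noteq> Skip"
  shows "tm_step M (program_config w c s) = case_prod (program_config w) (com_step w (c, s))"
proof -
  let ?ss = "map (\<lambda>i. read_symbol w (s i)) [0..<R]"
  obtain c' i d where n: "com_next c (\<lambda>i. read_symbol w (s i)) = (c', i, d)"
    by (metis prod_cases3)
  have reg: "num_regs c \<le> R"
    using num_regs_residuals[OF c] Rc by simp
  \<comment> \<open>Beyond \<open>R\<close> the value of \<open>?ss ! j\<close> is unspecified, but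
    \<open>c\<close> inspects only registers below \<open>num_regs c\<close>.\<close>
  have n': "com_next c (\<lambda>j. ?ss ! j) = (c', i, d)"
    using n reg by (subst com_next_cong[of c _ "\<lambda>i. read_symbol w (s i)"]) auto
  have i: "i < R" using com_next_reg[OF n] reg by simp
  have l: "d = Move_Left \<Longrightarrow> s i \<noteq> 0" using com_next_Left n by fastforce
  have "map2 tape_act (map (\<lambda>j. (?ss ! j, if j = i then d else Stay)) [0..<R])
      (map (\<lambda>i. program_tape w (s i)) [0..<R])
    = map (\<lambda>j. program_tape w ((s(i := counter_move d (s i))) j)) [0..<R]"
    by (rule nth_equalityI)
       (auto simp: tape_act_program_tape l tape_act_program_tape[of Stay, simplified] simp del: tape_act.simps)
  moreover have "enc c + 4 \<noteq> 2" "enc c + 4 \<noteq> 3" by auto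
  moreover have "dec (enc c) = c" using enc c by blast
  moreover have "map tape_read (map (\<lambda>i. program_tape w (s i)) [0..<R]) = ?ss"
    by simp
  ultimately show ?thesis
    using n n' \<open>c \<noteq> Skip\<close>
    by (simp add: program_config_def program_machine_def del: map_map)
qed

text \<open>A run may idle in \<open>Skip\<close>, whereas the machine proceeds from there to its
  verdict; hence only \<open>t' \<le> t\<close>.\<close>

lemma program_steps:
  assumes "runs w c s t s'" "c \<in> residuals c0"
  shows "\<exists>t' \<le> t. (tm_step M ^^ t') (program_config w c s) = program_config w Skip s'"
  using assms
proof (induction t arbitrary: c s)
  case 0
  then show ?case by (simp add: runs_def)
next
  case (Suc t)
  show ?case
  proof (cases "c = Skip")
    case True
    then show ?thesis using Suc.prems by (intro exI[of _ 0]) simp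
  next
    case False
    obtain c' i d where n: "com_next c (\<lambda>i. read_symbol w (s i)) = (c', i, d)"
      by (metis prod_cases3)
    let ?s' = "s(i := counter_move d (s i))"
    have "runs w c' ?s' t s'"
      using Suc.prems(1) n by (simp add: runs_Suc)
    moreover have "c' \<in> residuals c0"
      using residuals_closed[OF Suc.prems(2)] n by (metis fst_conv)
    ultimately obtain t' where "t' \<le> t"
        "(tm_step M ^^ t') (program_config w c' ?s') = program_config w Skip s'"
      using Suc.IH by blast
    then have "(tm_step M ^^ Suc t') (program_config w c s) = program_config w Skip s'"
      using program_step[OF Suc.prems(2) False, of w s] n
      by (simp add: funpow_Suc_right del: funpow.simps)
    then show ?thesis using \<open>t' \<le> t\<close> by (metis Suc_le_mono)
  qed
qed

lemma program_halt:
  "fst (tm_step M (program_config w Skip s)) = (if s 1 = 0 then 3 else 2)"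
proof -
  have "dec (enc Skip) = Skip" using enc Skip_in_residuals by blast
  moreover have "enc Skip + 4 \<noteq> 2" "enc Skip + 4 \<noteq> 3" by auto
  ultimately show ?thesis
    using R2 by (simp add: program_config_def program_machine_def)
qed

lemma program_decides:
  assumes "runs w c0 (\<lambda>_. 0) t s"
  shows "\<exists>t' \<le> 2 * length w + t + 3.
    fst ((tm_step M ^^ t') (tm_init M w)) = (if s 1 = 0 then 3 else 2)"
proof -
  obtain t' where t': "t' \<le> t"
      "(tm_step M ^^ t') (program_config w c0 (\<lambda>_. 0)) = program_config w Skip s"
    using program_steps[OF assms self_in_residuals] by blast
  have "(tm_step M ^^ (Suc (t' + (2 * length w + 2)))) (tm_init M w) =
      tm_step M (program_config w Skip s)"
    unfolding funpow.simps funpow_add[of t'] comp_apply setup_steps t'(2) ..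
  then have "fst ((tm_step M ^^ (Suc (t' + (2 * length w + 2)))) (tm_init M w)) =
      (if s 1 = 0 then 3 else 2)"
    using program_halt by metis
  then show ?thesis
    using t'(1) by (intro exI[of _ "Suc (t' + (2 * length w + 2))"]) simp
qed

end

theorem program_in_class_P:
  assumes "\<And>w. \<exists>s. runs w c (\<lambda>_. 0) (poly p (length w)) s \<and> (s 1 \<noteq> 0 \<longleftrightarrow> w \<in> L)"
  shows "L \<in> class_P"
proof -
  obtain f where f: "bij_betw f (residuals c) {0..<card (residuals c)}"
    using ex_bij_betw_finite_nat[OF finite_residuals] by blast
  let ?m = "card (residuals c)" and ?g = "the_inv_into (residuals c) f"
  interpret program_simulation "max 2 (num_regs c)" ?m f ?g c
  proof
    show "?g q \<in> residuals c" if "q < ?m" for q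
      using f that bij_betw_the_inv_into[OF f] by (metis atLeast0LessThan bij_betwE lessThan_iff)
    show "f d < ?m \<and> ?g (f d) = d" if "d \<in> residuals c" for d
      using f that by (metis atLeast0LessThan bij_betw_def bij_betwE lessThan_iff the_inv_into_f_f)
  qed auto
  have [simp]: "accept_state M = 2" "reject_state M = 3"
    by (simp_all add: program_machine_def)
  \<comment> \<open>\<open>[:3, 2:]\<close> pays for the set-up, \<open>2 * length w + 2\<close>
    steps, and the final step to the verdict.\<close>
  have "\<exists>t \<le> poly (p + [:3, 2:]) (length w).
      fst ((tm_step M ^^ t) (tm_init M w)) = (if w \<in> L then accept_state M else reject_state M)" for w
  proof -
    obtain s where s: "runs w c (\<lambda>_. 0) (poly p (length w)) s" "s 1 \<noteq> 0 \<longleftrightarrow> w \<in> L"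
      using assms by blast
    obtain t where "t \<le> 2 * length w + poly p (length w) + 3"
        "fst ((tm_step M ^^ t) (tm_init M w)) = (if s 1 = 0 then 3 else 2)"
      using program_decides[OF s(1)] by blast
    then show ?thesis using s(2) by (intro exI[of _ t]) auto
  qed
  then show ?thesis
    unfolding class_P_def tm_decides_in_time_def using wf_M by blast
qed

section \<open>Bounded arithmetic over words\<close>

datatype trm = Var nat | Num nat | Len | Add trm trm | Mul trm trm

text \<open>As \<open>Ex\<close> carries a bounding term, all values stay polynomial in the word
  length for a fixed formula, and a quantifier becomes a loop with polynomially many rounds. The
  bound is evaluated outside the scope of the variable.\<close>

datatype fm = Bit trm | Less trm trm | Neg fm | And fm fm | Ex nat trm fm

fun tval :: "bool list \<Rightarrow> (nat \<Rightarrow> nat) \<Rightarrow> trm \<Rightarrow> nat" where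
  "tval w e (Var x) = e x"
| "tval w e (Num n) = n"
| "tval w e Len = length w"
| "tval w e (Add a b) = tval w e a + tval w e b"
| "tval w e (Mul a b) = tval w e a * tval w e b"

fun sat :: "bool list \<Rightarrow> (nat \<Rightarrow> nat) \<Rightarrow> fm \<Rightarrow> bool" where
  "sat w e (Bit a) \<longleftrightarrow> tval w e a < length w \<and> w ! tval w e a"
| "sat w e (Less a b) \<longleftrightarrow> tval w e a < tval w e b"
| "sat w e (Neg \<phi>) \<longleftrightarrow> \<not> sat w e \<phi>"
| "sat w e (And \<phi> \<psi>) \<longleftrightarrow> sat w e \<phi> \<and> sat w e \<psi>"
| "sat w e (Ex x a \<phi>) \<longleftrightarrow> (\<exists>v < tval w e a. sat w (e(x := v)) \<phi>)"

text \<open>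
  The compiled code for a term or formula receives the registers of its variables through \<open>\<rho>\<close> and
  may use the registers from \<open>d\<close> on, which are zero before; it leaves its result in register \<open>d\<close>
  and restores all others. The symbol 3 under the head of a register means that the register is 0.
\<close>

definition add_into :: "nat \<Rightarrow> nat \<Rightarrow> com" where
  "add_into r d = While_Not r 3 (Seq (Dec r) (Inc d))"

definition clear :: "nat \<Rightarrow> com" where
  "clear r = While_Not r 3 (Dec r)"

text \<open>Reading a register by a loop empties it, so a variable is drained into \<open>d\<close>
  and \<open>d + 1\<close> and refilled from the latter. For \<open>Len\<close> the head advances to
  the first blank, where the register is \<open>length w + 1\<close>; hence the final
  \<open>Dec\<close>.\<close>

fun compile_trm :: "(nat \<Rightarrow> nat) \<Rightarrow> nat \<Rightarrow> trm \<Rightarrow> com" where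
  "compile_trm \<rho> d (Var x) =
     Seq (While_Not (\<rho> x) 3 (Seq (Dec (\<rho> x)) (Seq (Inc d) (Inc (d + 1))))) (add_into (d + 1) (\<rho> x))"
| "compile_trm \<rho> d (Num n) = ((Seq (Inc d)) ^^ n) Skip"
| "compile_trm \<rho> d Len = Seq (Inc d) (Seq (While_Not d 0 (Inc d)) (Dec d))"
| "compile_trm \<rho> d (Add a b) =
     Seq (compile_trm \<rho> d a) (Seq (compile_trm \<rho> (d + 1) b) (add_into (d + 1) d))"
| "compile_trm \<rho> d (Mul a b) =
     Seq (compile_trm \<rho> (d + 1) a)
       (While_Not (d + 1) 3
         (Seq (Dec (d + 1)) (Seq (compile_trm \<rho> (d + 2) b) (add_into (d + 2) d))))"

text \<open>\<open>Less\<close> subtracts in parallel and asks whether anything is left of the right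
  side. In \<open>Ex\<close> register \<open>d + 1\<close> is both loop counter and variable: after
  the \<open>Dec\<close> it holds the next candidate, from the bound minus 1 down to 0.\<close>

fun compile_fm :: "(nat \<Rightarrow> nat) \<Rightarrow> nat \<Rightarrow> fm \<Rightarrow> com" where
  "compile_fm \<rho> d (Bit a) =
     Seq (compile_trm \<rho> d a) (Seq (Inc d) (If_Sym d 2 (Seq (clear d) (Inc d)) (clear d)))"
| "compile_fm \<rho> d (Less a b) =
     Seq (compile_trm \<rho> d a) (Seq (compile_trm \<rho> (d + 1) b)
       (Seq (While_Not d 3 (Seq (Dec d) (Dec (d + 1))))
         (If_Sym (d + 1) 3 Skip (Seq (clear (d + 1)) (Inc d)))))"
| "compile_fm \<rho> d (Neg \<phi>) = Seq (compile_fm \<rho> d \<phi>) (If_Sym d 3 (Inc d) (Dec d))"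
| "compile_fm \<rho> d (And \<phi> \<psi>) =
     Seq (compile_fm \<rho> d \<phi>) (If_Sym d 3 Skip (Seq (Dec d) (compile_fm \<rho> d \<psi>)))"
| "compile_fm \<rho> d (Ex x a \<phi>) =
     Seq (compile_trm \<rho> (d + 1) a)
       (While_Not (d + 1) 3
         (Seq (Dec (d + 1)) (Seq (compile_fm (\<rho>(x := d + 1)) (d + 2) \<phi>)
           (If_Sym (d + 2) 3 Skip (Seq (Dec (d + 2)) (If_Sym d 3 (Inc d) Skip))))))"

section \<open>Polynomial bounds on values and running times\<close>

fun trm_bound :: "trm \<Rightarrow> nat poly" where
  "trm_bound (Var x) = [:0, 1:]"
| "trm_bound (Num n) = [:n:]"
| "trm_bound Len = [:0, 1:]"
| "trm_bound (Add a b) = trm_bound a + trm_bound b"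
| "trm_bound (Mul a b) = trm_bound a * trm_bound b"

fun trm_time :: "trm \<Rightarrow> nat poly" where
  "trm_time (Var x) = [:3, 12:]"
| "trm_time (Num n) = [:2 * n:]"
| "trm_time Len = [:5, 3:]"
| "trm_time (Add a b) = trm_time a + trm_time b + 5 * trm_bound b + 3"
| "trm_time (Mul a b) =
     trm_time a + trm_bound a * (trm_time b + 5 * trm_bound b + 6) + 2"

text \<open>The body of a quantifier sees a variable that may be as large as the bounding term, so
  \<open>pcompose\<close> evaluates its polynomial at an enlarged bound.\<close>

fun fm_time :: "fm \<Rightarrow> nat poly" where
  "fm_time (Bit a) = trm_time a + 3 * trm_bound a + 11"
| "fm_time (Less a b) = trm_time a + trm_time b + 5 * trm_bound a + 3 * trm_bound b + 8"
| "fm_time (Neg \<phi>) = fm_time \<phi> + 3"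
| "fm_time (And \<phi> \<psi>) = fm_time \<phi> + fm_time \<psi> + 4"
| "fm_time (Ex x a \<phi>) =
     trm_time a + trm_bound a * (pcompose (fm_time \<phi>) ([:0, 1:] + trm_bound a) + 11) + 2"

lemma tval_le_bound:
  assumes "length w \<le> B" "\<And>x. e x \<le> B"
  shows "tval w e a \<le> poly (trm_bound a) B"
  using assms by (induction a) (auto intro: add_mono mult_mono)

lemma runs_cong:
  "runs w c s t s1 \<Longrightarrow> s1 = s' \<Longrightarrow> t \<le> t' \<Longrightarrow> runs w c s t' s'"
  using runs_mono by blast

lemma runs_add_into:
  assumes "r \<noteq> d"
  shows "runs w (add_into r d) s (s r * 5 + 1) (s(r := 0, d := s d + s r))"
proof -
  let ?S = "\<lambda>j. s(r := s r - j, d := s d + j)"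
  have "runs w (While_Not r 3 (Seq (Dec r) (Inc d))) (?S 0) (s r * (3 + 2) + 1) (?S (s r))"
  proof (rule runs_While)
    fix j assume j: "j < s r"
    show "runs w (Seq (Dec r) (Inc d)) (?S j) 3 (?S (Suc j))"
      by (rule runs_cong[OF runs_Seq[OF runs_Dec runs_Inc]]) (use assms in \<open>auto simp: fun_eq_iff\<close>)
  qed (use assms in auto)
  then show ?thesis
    by (simp add: add_into_def)
qed

lemma runs_clear: "runs w (clear r) s (s r * 3 + 1) (s(r := 0))"
proof -
  let ?S = "\<lambda>j. s(r := s r - j)"
  have "runs w (While_Not r 3 (Dec r)) (?S 0) (s r * (1 + 2) + 1) (?S (s r))"
  proof (rule runs_While)
    fix j assume j: "j < s r"
    show "runs w (Dec r) (?S j) 1 (?S (Suc j))"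
      by (rule runs_cong[OF runs_Dec]) auto
  qed auto
  then have "runs w (clear r) s (s r * (1 + 2) + 1) (s(r := 0))"
    by (simp add: clear_def)
  then show ?thesis
    by (rule runs_cong) auto
qed

text \<open>The final state differs from \<open>s\<close> at \<open>d\<close> only. Scratch
  registers are thus zero again, and the induction hypothesis applies afresh in every round of the
  loop for \<open>Mul\<close>. The single bound \<open>B\<close> on word length and variables keeps
  the cost independent of the environment.\<close>

lemma runs_compile_trm:
  assumes "length w \<le> B" "\<And>x. e x \<le> B" "\<And>x. s (\<rho> x) = e x" "\<And>x. \<rho> x < d" "\<And>i. d \<le> i \<Longrightarrow> s i = 0"
  shows "runs w (compile_trm \<rho> d a) s (poly (trm_time a) B) (s(d := tval w e a))"
  using assms
proof (induction a arbitrary: d s)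
  case (Var x)
  let ?r = "\<rho> x"
  have r: "?r < d" using Var by simp
  let ?S = "\<lambda>j. s(?r := s ?r - j, d := j, d + 1 := j)"
  have "runs w (While_Not ?r 3 (Seq (Dec ?r) (Seq (Inc d) (Inc (d + 1))))) (?S 0)
      (s ?r * (5 + 2) + 1) (?S (s ?r))"
  proof (rule runs_While)
    fix j assume j: "j < s ?r"
    show "runs w (Seq (Dec ?r) (Seq (Inc d) (Inc (d + 1)))) (?S j) 5 (?S (Suc j))"
      by (rule runs_cong[OF runs_Seq[OF runs_Dec runs_Seq[OF runs_Inc runs_Inc]]])
         (use r in \<open>auto simp: fun_eq_iff\<close>)
  qed (use r in auto)
  moreover have "?S 0 = s"
    using Var.prems(5)[of d] Var.prems(5)[of "d + 1"] by (auto simp: fun_eq_iff)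
  ultimately have 1: "runs w (While_Not ?r 3 (Seq (Dec ?r) (Seq (Inc d) (Inc (d + 1))))) s
      (s ?r * 7 + 1) (?S (s ?r))"
    by simp
  have "runs w (compile_trm \<rho> d (Var x)) s
     (s ?r * 7 + 1 + (?S (s ?r) (d + 1) * 5 + 1) + 1)
     ((?S (s ?r)) (d + 1 := 0, ?r := ?S (s ?r) ?r + ?S (s ?r) (d + 1)))"
    unfolding compile_trm.simps by (rule runs_Seq[OF 1 runs_add_into]) (use r in simp)
  then show ?case
    by (rule runs_cong)
       (use r Var.prems(2)[of x] Var.prems(3)[of x] Var.prems(5)[of "d + 1"] in \<open>auto simp: fun_eq_iff\<close>)
next
  case (Num n)
  have "runs w (((Seq (Inc d)) ^^ n) Skip) s (2 * n) (s(d := s d + n))" for s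
  proof (induction n arbitrary: s)
    case (Suc n)
    have "runs w (Seq (Inc d) (((Seq (Inc d)) ^^ n) Skip)) s (1 + 2 * n + 1)
        (s(d := Suc (s d), d := (s(d := Suc (s d))) d + n))"
      by (rule runs_Seq[OF runs_Inc Suc.IH])
    then show ?case
      unfolding funpow.simps comp_apply by (rule runs_cong) auto
  qed simp
  from this[of s] show ?case
    unfolding compile_trm.simps by (rule runs_cong) (use Num.prems(5)[of d] in auto)
next
  case Len
  let ?S = "\<lambda>j. s(d := Suc j)"
  have 0: "s d = 0" using Len.prems(5)[of d] by simp
  have 1: "runs w (While_Not d 0 (Inc d)) (?S 0) (length w * (1 + 2) + 1) (?S (length w))"
  proof (rule runs_While)
    fix j assume j: "j < length w"
    show "runs w (Inc d) (?S j) 1 (?S (Suc j))"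
      by (rule runs_cong[OF runs_Inc]) auto
  qed (auto simp: read_symbol_eq_0)
  have "runs w (Inc d) s 1 (?S 0)"
    by (rule runs_cong[OF runs_Inc]) (simp_all add: 0)
  from runs_Seq[OF this runs_Seq[OF 1 runs_Dec]] show ?case
    unfolding compile_trm.simps by (rule runs_cong) (use Len.prems(1) in \<open>auto simp: fun_eq_iff\<close>)
next
  case (Add a b)
  let ?u = "tval w e a" and ?v = "tval w e b"
  let ?s1 = "s(d := ?u)"
  have 1: "runs w (compile_trm \<rho> d a) s (poly (trm_time a) B) ?s1"
    by (rule Add.IH(1)) (use Add.prems in auto)
  have neq: "\<rho> x \<noteq> d" for x using Add.prems(4)[of x] by simp
  have 2: "runs w (compile_trm \<rho> (d + 1) b) ?s1 (poly (trm_time b) B) (?s1(d + 1 := ?v))"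
    by (rule Add.IH(2)) (use Add.prems neq in \<open>auto simp: less_SucI\<close>)
  have v: "?v \<le> poly (trm_bound b) B"
    by (rule tval_le_bound) (use Add.prems in auto)
  from runs_Seq[OF 1 runs_Seq[OF 2 runs_add_into[of "d + 1" d]]] show ?case
    unfolding compile_trm.simps
    by (rule runs_cong) (use v Add.prems(5)[of "d + 1"] in \<open>auto simp: fun_eq_iff\<close>)
next
  case (Mul a b)
  let ?u = "tval w e a" and ?v = "tval w e b"
  let ?body = "Seq (Dec (d + 1)) (Seq (compile_trm \<rho> (d + 2) b) (add_into (d + 2) d))"
  have 1: "runs w (compile_trm \<rho> (d + 1) a) s (poly (trm_time a) B) (s(d + 1 := ?u))"
    by (rule Mul.IH(1)) (use Mul.prems in \<open>auto simp: less_SucI\<close>)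
  let ?S = "\<lambda>j. s(d + 1 := ?u - j, d := j * ?v)"
  let ?t = "poly (trm_time b) B + 5 * poly (trm_bound b) B + 4"
  have v: "?v \<le> poly (trm_bound b) B" and u: "?u \<le> poly (trm_bound a) B"
    by (rule tval_le_bound; use Mul.prems in auto)+
  have 2: "runs w (While_Not (d + 1) 3 ?body) (?S 0) (?u * (?t + 2) + 1) (?S ?u)"
  proof (rule runs_While)
    fix j assume j: "j < ?u"
    let ?s1 = "s(d + 1 := ?u - Suc j, d := j * ?v)"
    have neq: "\<rho> x \<noteq> d" "\<rho> x \<noteq> d + 1" "\<rho> x < d + 2" for x
      using Mul.prems(4)[of x] by simp_all
    have 3: "runs w (compile_trm \<rho> (d + 2) b) ?s1 (poly (trm_time b) B) (?s1(d + 2 := ?v))"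
      by (rule Mul.IH(2)) (use Mul.prems neq in auto)
    have 4: "runs w (Dec (d + 1)) (?S j) 1 ?s1"
      by (rule runs_cong[OF runs_Dec]) (auto simp: fun_eq_iff)
    from runs_Seq[OF 4 runs_Seq[OF 3 runs_add_into[of "d + 2" d]]]
    show "runs w ?body (?S j) ?t (?S (Suc j))"
      by (rule runs_cong) (use Mul.prems(5)[of "d + 2"] v in \<open>auto simp: fun_eq_iff\<close>)
  qed auto
  have "?S 0 = s(d + 1 := ?u)"
    using Mul.prems(5)[of d] by (auto simp: fun_eq_iff)
  note 2 = 2[unfolded this]
  have "?u * (?t + 2) \<le> poly (trm_bound a) B * (?t + 2)"
    using u by (rule mult_right_mono) simp
  with runs_Seq[OF 1 2] show ?case
    unfolding compile_trm.simps
    by (elim runs_cong) (use Mul.prems(5)[of "d + 1"] in \<open>auto simp: fun_eq_iff algebra_simps\<close>)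
qed

lemma runs_compile_fm:
  assumes "length w \<le> B" "\<And>x. e x \<le> B" "\<And>x. s (\<rho> x) = e x" "\<And>x. \<rho> x < d" "\<And>i. d \<le> i \<Longrightarrow> s i = 0"
  shows "runs w (compile_fm \<rho> d \<phi>) s (poly (fm_time \<phi>) B) (s(d := of_bool (sat w e \<phi>)))"
  using assms
proof (induction \<phi> arbitrary: e \<rho> d s B)
  case (Bit a)
  let ?u = "tval w e a"
  have u: "?u \<le> poly (trm_bound a) B"
    by (rule tval_le_bound) (use Bit.prems in auto)
  have 1: "runs w (compile_trm \<rho> d a) s (poly (trm_time a) B) (s(d := ?u))"
    by (rule runs_compile_trm) (use Bit.prems in auto)
  let ?s = "s(d := ?u, d := Suc ((s(d := ?u)) d))"
  have "runs w (If_Sym d 2 (Seq (clear d) (Inc d)) (clear d)) ?s (?s d * 3 + 1 + 1 + 1 + 1)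
      (s(d := of_bool (sat w e (Bit a))))"
  proof (rule runs_If)
    assume "read_symbol w (?s d) = 2"
    then show "runs w (Seq (clear d) (Inc d)) ?s (?s d * 3 + 1 + 1 + 1) (s(d := of_bool (sat w e (Bit a))))"
      by (intro runs_cong[OF runs_Seq[OF runs_clear runs_Inc]]) (auto simp: read_symbol_eq_2 fun_eq_iff)
  next
    assume "read_symbol w (?s d) \<noteq> 2"
    then show "runs w (clear d) ?s (?s d * 3 + 1 + 1 + 1) (s(d := of_bool (sat w e (Bit a))))"
      by (intro runs_cong[OF runs_clear]) (auto simp: read_symbol_eq_2 fun_eq_iff)
  qed
  from runs_Seq[OF 1 runs_Seq[OF runs_Inc this]] show ?case
    unfolding compile_fm.simps by (rule runs_cong) (use u in auto)
next
  case (Less a b)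
  let ?u = "tval w e a" and ?v = "tval w e b"
  have v: "?v \<le> poly (trm_bound b) B" and u: "?u \<le> poly (trm_bound a) B"
    by (rule tval_le_bound; use Less.prems in auto)+
  let ?s1 = "s(d := ?u)"
  have 1: "runs w (compile_trm \<rho> d a) s (poly (trm_time a) B) ?s1"
    by (rule runs_compile_trm) (use Less.prems in auto)
  have neq: "\<rho> x \<noteq> d" for x using Less.prems(4)[of x] by simp
  have 2: "runs w (compile_trm \<rho> (d + 1) b) ?s1 (poly (trm_time b) B) (?s1(d + 1 := ?v))"
    by (rule runs_compile_trm) (use Less.prems neq in \<open>auto simp: less_SucI\<close>)
  let ?S = "\<lambda>j. s(d := ?u - j, d + 1 := ?v - j)"
  have "runs w (While_Not d 3 (Seq (Dec d) (Dec (d + 1)))) (?S 0) (?u * (3 + 2) + 1) (?S ?u)"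
  proof (rule runs_While)
    fix j
    show "runs w (Seq (Dec d) (Dec (d + 1))) (?S j) 3 (?S (Suc j))"
      by (rule runs_cong[OF runs_Seq[OF runs_Dec runs_Dec]]) (auto simp: fun_eq_iff)
  qed auto
  then have 3: "runs w (While_Not d 3 (Seq (Dec d) (Dec (d + 1)))) (?s1(d + 1 := ?v)) (?u * 5 + 1) (?S ?u)"
    by simp
  have 4: "runs w (If_Sym (d + 1) 3 Skip (Seq (clear (d + 1)) (Inc d))) (?S ?u) (?v * 3 + 3 + 1)
    (s(d := of_bool (sat w e (Less a b))))"
  proof (rule runs_If)
    assume "read_symbol w (?S ?u (d + 1)) = 3"
    then show "runs w Skip (?S ?u) (?v * 3 + 3) (s(d := of_bool (sat w e (Less a b))))"
      using Less.prems(5)[of "d + 1"] by (auto simp: fun_eq_iff)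
  next
    assume "read_symbol w (?S ?u (d + 1)) \<noteq> 3"
    then show "runs w (Seq (clear (d + 1)) (Inc d)) (?S ?u) (?v * 3 + 3) (s(d := of_bool (sat w e (Less a b))))"
      using Less.prems(5)[of "d + 1"]
      by (intro runs_cong[OF runs_Seq[OF runs_clear runs_Inc]]) (auto simp: fun_eq_iff)
  qed
  from runs_Seq[OF 1 runs_Seq[OF 2 runs_Seq[OF 3 4]]] show ?case
    unfolding compile_fm.simps by (rule runs_cong) (use u v in auto)
next
  case (Neg \<phi>)
  let ?b = "sat w e \<phi>"
  have 1: "runs w (compile_fm \<rho> d \<phi>) s (poly (fm_time \<phi>) B) (s(d := of_bool ?b))"
    by (rule Neg.IH) (use Neg.prems in auto)
  have 2: "runs w (If_Sym d 3 (Inc d) (Dec d)) (s(d := of_bool ?b)) (1 + 1) (s(d := of_bool (\<not> ?b)))"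
    by (rule runs_If) (rule runs_cong[OF runs_Inc] runs_cong[OF runs_Dec]; auto simp: fun_eq_iff)+
  from runs_Seq[OF 1 2] show ?case
    unfolding compile_fm.simps by (rule runs_cong) auto
next
  case (And \<phi> \<psi>)
  let ?b = "sat w e \<phi>" and ?c = "sat w e \<psi>"
  have 1: "runs w (compile_fm \<rho> d \<phi>) s (poly (fm_time \<phi>) B) (s(d := of_bool ?b))"
    by (rule And.IH) (use And.prems in auto)
  have 2: "runs w (compile_fm \<rho> d \<psi>) s (poly (fm_time \<psi>) B) (s(d := of_bool ?c))"
    by (rule And.IH) (use And.prems in auto)
  have "runs w (If_Sym d 3 Skip (Seq (Dec d) (compile_fm \<rho> d \<psi>))) (s(d := of_bool ?b))
      (poly (fm_time \<psi>) B + 2 + 1) (s(d := of_bool (?b \<and> ?c)))"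
  proof (rule runs_If)
    assume "read_symbol w ((s(d := of_bool ?b)) d) \<noteq> 3"
    then have b: "?b" by auto
    have "runs w (Dec d) (s(d := of_bool ?b)) 1 s"
      by (rule runs_cong[OF runs_Dec]) (use And.prems(5)[of d] b in \<open>auto simp: fun_eq_iff\<close>)
    from runs_Seq[OF this 2] show "runs w (Seq (Dec d) (compile_fm \<rho> d \<psi>)) (s(d := of_bool ?b))
      (poly (fm_time \<psi>) B + 2) (s(d := of_bool (?b \<and> ?c)))"
      by (rule runs_cong) (use b in auto)
  qed auto
  from runs_Seq[OF 1 this] show ?case
    unfolding compile_fm.simps by (rule runs_cong) auto
next
  case (Ex x a \<phi>)
  let ?u = "tval w e a" and ?\<rho> = "\<rho>(x := d + 1)"
  let ?P = "\<lambda>v. sat w (e(x := v)) \<phi>"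
  let ?upd = "If_Sym (d + 2) 3 Skip (Seq (Dec (d + 2)) (If_Sym d 3 (Inc d) Skip))"
  let ?body = "Seq (Dec (d + 1)) (Seq (compile_fm ?\<rho> (d + 2) \<phi>) ?upd)"
  let ?B = "B + poly (trm_bound a) B"
  have u: "?u \<le> poly (trm_bound a) B"
    by (rule tval_le_bound) (use Ex.prems in auto)
  have 1: "runs w (compile_trm \<rho> (d + 1) a) s (poly (trm_time a) B) (s(d + 1 := ?u))"
    by (rule runs_compile_trm) (use Ex.prems in \<open>auto simp: less_SucI\<close>)
  \<comment> \<open>After \<open>j\<close> rounds exactly the candidates from \<open>?u - j\<close>
    to \<open>?u - 1\<close> have been tried.\<close>
  let ?S = "\<lambda>j. s(d + 1 := ?u - j, d := of_bool (\<exists>v < ?u. ?u - j \<le> v \<and> ?P v))"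
  let ?t = "poly (fm_time \<phi>) ?B + 9"
  have 2: "runs w (While_Not (d + 1) 3 ?body) (?S 0) (?u * (?t + 2) + 1) (?S ?u)"
  proof (rule runs_While)
    fix j assume j: "j < ?u"
    define v where "v = ?u - Suc j"
    have v: "v < ?u" "?u - j = Suc v" using j by (auto simp: v_def)
    define q where "q \<longleftrightarrow> (\<exists>v < ?u. ?u - j \<le> v \<and> ?P v)"
    let ?s1 = "s(d + 1 := v, d := of_bool q)"
    have neq: "\<rho> y \<noteq> d" "\<rho> y \<noteq> d + 1" for y
      using Ex.prems(4)[of y] by auto
    have 3: "runs w (compile_fm ?\<rho> (d + 2) \<phi>) ?s1 (poly (fm_time \<phi>) ?B)
        (?s1(d + 2 := of_bool (?P v)))"
    proof (rule Ex.IH)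
      show "(e(x := v)) y \<le> ?B" for y
        using Ex.prems(2)[of y] u v by (auto simp: trans_le_add1)
      show "?s1 (?\<rho> y) = (e(x := v)) y" for y
        using neq[of y] Ex.prems(3)[of y] by auto
      show "?\<rho> y < d + 2" for y
        using Ex.prems(4)[of y] by simp
    qed (use Ex.prems in auto)
    have 4: "runs w (Dec (d + 1)) (?S j) 1 ?s1"
      by (rule runs_cong[OF runs_Dec]) (use v in \<open>auto simp: fun_eq_iff q_def\<close>)
    have z: "s (d + 2) = 0" using Ex.prems(5)[of "d + 2"] by simp
    have 5: "runs w ?upd (?s1(d + 2 := of_bool (?P v))) (1 + (1 + 1) + 1 + 1)
       (s(d + 1 := v, d := of_bool (q \<or> ?P v)))"
    proof (rule runs_If)
      assume "read_symbol w ((?s1(d + 2 := of_bool (?P v))) (d + 2)) = 3"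
      then show "runs w Skip (?s1(d + 2 := of_bool (?P v))) (1 + (1 + 1) + 1)
          (s(d + 1 := v, d := of_bool (q \<or> ?P v)))"
        using z by (auto simp: fun_eq_iff)
    next
      assume "read_symbol w ((?s1(d + 2 := of_bool (?P v))) (d + 2)) \<noteq> 3"
      then have P: "?P v" by auto
      have "runs w (Dec (d + 2)) (?s1(d + 2 := of_bool (?P v))) 1 ?s1"
        by (rule runs_cong[OF runs_Dec]) (use z P in \<open>auto simp: fun_eq_iff\<close>)
      moreover have "runs w (If_Sym d 3 (Inc d) Skip) ?s1 (1 + 1) (s(d + 1 := v, d := of_bool (q \<or> ?P v)))"
        by (rule runs_If, rule runs_cong[OF runs_Inc]) (use P in \<open>auto simp: fun_eq_iff\<close>)
      ultimately show "runs w (Seq (Dec (d + 2)) (If_Sym d 3 (Inc d) Skip))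
          (?s1(d + 2 := of_bool (?P v))) (1 + (1 + 1) + 1) (s(d + 1 := v, d := of_bool (q \<or> ?P v)))"
        by (rule runs_Seq)
    qed
    have "q \<or> ?P v \<longleftrightarrow> (\<exists>v < ?u. ?u - Suc j \<le> v \<and> ?P v)"
      unfolding q_def using v by (auto simp: v_def[symmetric]) (metis Suc_leI le_neq_implies_less)
    then have eq: "s(d + 1 := v, d := of_bool (q \<or> ?P v)) = ?S (Suc j)"
      by (simp add: v_def)
    from runs_Seq[OF 4 runs_Seq[OF 3 5]]
    show "runs w ?body (?S j) ?t (?S (Suc j))"
      unfolding eq by (rule runs_cong) auto
  qed auto
  have "?S 0 = s(d + 1 := ?u)"
    using Ex.prems(5)[of d] by (auto simp: fun_eq_iff)
  note 2 = 2[unfolded this]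
  have "?u * (?t + 2) \<le> poly (trm_bound a) B * (?t + 2)"
    using u by (rule mult_right_mono) simp
  with runs_Seq[OF 1 2] show ?case
    unfolding compile_fm.simps
    by (elim runs_cong)
       (use Ex.prems(5)[of "d + 1"] in \<open>auto simp: fun_eq_iff algebra_simps poly_pcompose\<close>)
qed

theorem bounded_arithmetic_in_class_P: "{w. sat w (\<lambda>_. 0) \<phi>} \<in> class_P"
proof (rule program_in_class_P)
  fix w
  \<comment> \<open>All variables start out in register 0, which holds 0; the result lands in
    register 1, where the machine looks for the verdict.\<close>
  have "runs w (compile_fm (\<lambda>_. 0) 1 \<phi>) (\<lambda>_. 0) (poly (fm_time \<phi>) (length w))
      ((\<lambda>_. 0)(1 := of_bool (sat w (\<lambda>_. 0) \<phi>)))"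
    by (rule runs_compile_fm) auto
  then show "\<exists>s. runs w (compile_fm (\<lambda>_. 0) 1 \<phi>) (\<lambda>_. 0) (poly (fm_time \<phi>) (length w)) s \<and>
      (s 1 \<noteq> 0 \<longleftrightarrow> w \<in> {w. sat w (\<lambda>_. 0) \<phi>})"
    by (intro exI conjI) auto
qed

section \<open>Forbidden induced subgraphs\<close>

text \<open>An isomorphism has a separate map on arcs, but when arcs are pairs it is forced by the
  vertex map. An induced copy is therefore an embedding of the pattern that preserves and reflects
  arcs, namely the inverse of the vertex map.\<close>

lemma induced_free_pair_iff:
  assumes H: "parcs H \<subseteq> pverts H \<times> pverts H"
  shows "induced_free (with_proj H) (with_proj G) \<longleftrightarrow>
    (\<nexists>f. f ` pverts H \<subseteq> pverts G \<and> inj_on f (pverts H) \<and>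
      (\<forall>i \<in> pverts H. \<forall>j \<in> pverts H. (f i, f j) \<in> parcs G \<longleftrightarrow> (i, j) \<in> parcs H))"
    (is "_ \<longleftrightarrow> (\<nexists>f. ?emb f)")
proof -
  have "(\<exists>W \<subseteq> pverts G. digraph_iso (with_proj G \<restriction> W) (with_proj H)) \<longleftrightarrow> (\<exists>f. ?emb f)"
  proof
    assume "\<exists>W \<subseteq> pverts G. digraph_iso (with_proj G \<restriction> W) (with_proj H)"
    then obtain W hom where W: "W \<subseteq> pverts G"
      and iso: "pre_digraph.digraph_isomorphism (with_proj G \<restriction> W) hom"
      and eq: "with_proj H = app_iso hom (with_proj G \<restriction> W)"
      unfolding digraph_iso_def by blast
    let ?h = "iso_verts hom"
    let ?A = "{e \<in> parcs G. fst e \<in> W \<and> snd e \<in> W}"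
    have inj: "inj_on ?h W"
      using iso by (simp add: pre_digraph.digraph_isomorphism_def)
    have pv: "pverts H = ?h ` W" and pa: "parcs H = iso_arcs hom ` ?A"
      and pt: "iso_tail hom = fst" and ph: "iso_head hom = snd"
      using arg_cong[OF eq, of verts] arg_cong[OF eq, of arcs]
        arg_cong[OF eq, of tail] arg_cong[OF eq, of head]
      by (simp_all add: induce_subgraph_def)
    have arc: "iso_arcs hom (a, b) = (?h a, ?h b)" if "(a, b) \<in> parcs G" "a \<in> W" "b \<in> W" for a b
      using iso that
      by (auto simp: pre_digraph.digraph_isomorphism_def induce_subgraph_def pt ph prod_eq_iff)
    have pa': "(?h a, ?h b) \<in> parcs H \<longleftrightarrow> (a, b) \<in> parcs G" if "a \<in> W" "b \<in> W" for a b
    proof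
      assume "(a, b) \<in> parcs G"
      then show "(?h a, ?h b) \<in> parcs H"
        unfolding pa using that arc by (intro image_eqI[of _ _ "(a, b)"]) auto
    next
      assume "(?h a, ?h b) \<in> parcs H"
      then obtain c d where "(c, d) \<in> parcs G" "c \<in> W" "d \<in> W" "(?h a, ?h b) = (?h c, ?h d)"
        unfolding pa using arc by auto
      then show "(a, b) \<in> parcs G"
        using inj that by (auto dest: inj_onD)
    qed
    have "?emb (the_inv_into W ?h)"
      unfolding pv using W inj pa'
      by (auto simp: the_inv_into_f_f the_inv_into_into inj_on_the_inv_into)
    then show "\<exists>f. ?emb f" by (rule exI[of _ "the_inv_into W ?h"])
  next
    assume "\<exists>f. ?emb f"
    then obtain f where f: "?emb f" by (rule exE)
    let ?W = "f ` pverts H" and ?g = "the_inv_into (pverts H) f"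
    let ?hom = "\<lparr>iso_verts = ?g, iso_arcs = map_prod ?g ?g, iso_head = snd, iso_tail = fst\<rparr>"
    have inj: "inj_on f (pverts H)" using f by blast
    have g: "?g (f i) = i" if "i \<in> pverts H" for i
      using the_inv_into_f_f[OF inj that] .
    have "wf_digraph (with_proj G \<restriction> ?W)"
      by unfold_locales (auto simp: induce_subgraph_def)
    moreover have "inj_on ?g ?W"
      using inj by (rule inj_on_the_inv_into)
    moreover have "inj_on (map_prod ?g ?g) (arcs (with_proj G \<restriction> ?W))"
      using g by (auto simp: inj_on_def induce_subgraph_def)
    ultimately have "pre_digraph.digraph_isomorphism (with_proj G \<restriction> ?W) ?hom"
      unfolding pre_digraph.digraph_isomorphism_def by (auto simp: induce_subgraph_def)
    moreover have "with_proj H = app_iso ?hom (with_proj G \<restriction> ?W)"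
    proof -
      have "?g ` ?W = pverts H"
        using g by (auto simp: image_image)
      moreover have "map_prod ?g ?g ` {e \<in> parcs G. fst e \<in> ?W \<and> snd e \<in> ?W} = parcs H"
      proof (intro equalityI subsetI)
        fix p assume "p \<in> map_prod ?g ?g ` {e \<in> parcs G. fst e \<in> ?W \<and> snd e \<in> ?W}"
        then show "p \<in> parcs H" using f g by auto
      next
        fix p assume p: "p \<in> parcs H"
        obtain i j where ij: "p = (i, j)" by (cases p)
        with p H have "i \<in> pverts H" "j \<in> pverts H" by auto
        then show "p \<in> map_prod ?g ?g ` {e \<in> parcs G. fst e \<in> ?W \<and> snd e \<in> ?W}"
          using f g p ij by (intro image_eqI[of _ _ "(f i, f j)"]) auto
      qed
      ultimately show ?thesis
        by (simp add: app_iso_def with_proj_def induce_subgraph_def)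
    qed
    ultimately have "digraph_iso (with_proj G \<restriction> ?W) (with_proj H)"
      unfolding digraph_iso_def by blast
    then show "\<exists>W \<subseteq> pverts G. digraph_iso (with_proj G \<restriction> W) (with_proj H)"
      using f by blast
  qed
  then show ?thesis
    unfolding induced_free_def by auto
qed

section \<open>Copies of five-vertex patterns as conditions on five vertices\<close>

lemma all_less_5: "(\<forall>i < (5::nat). P i) \<longleftrightarrow> P 0 \<and> P 1 \<and> P 2 \<and> P 3 \<and> P 4"
  by (auto simp: numeral_eq_Suc All_less_Suc)

lemma parcs_undirected_subset:
  "E \<subseteq> V \<times> V \<Longrightarrow> parcs (undirected V E) \<subseteq> pverts (undirected V E) \<times> pverts (undirected V E)"
  by (auto simp: undirected_def)

text \<open>Replaces the embedding by five quantified vertices, the form in which a formula can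
  search for a copy.\<close>

lemma embedding5_iff:
  fixes H :: "nat pair_pre_digraph"
  assumes "pverts H = {0, 1, 2, 3, 4}"
  shows "(\<exists>f. f ` pverts H \<subseteq> V \<and> inj_on f (pverts H) \<and>
      (\<forall>i \<in> pverts H. \<forall>j \<in> pverts H. (f i, f j) \<in> A \<longleftrightarrow> (i, j) \<in> parcs H)) \<longleftrightarrow>
    (\<exists>a \<in> V. \<exists>b \<in> V. \<exists>c \<in> V. \<exists>d \<in> V. \<exists>e \<in> V. distinct [a, b, c, d, e] \<and>
      (\<forall>i < 5. \<forall>j < 5. ([a, b, c, d, e] ! i, [a, b, c, d, e] ! j) \<in> A \<longleftrightarrow> (i, j) \<in> parcs H))"
    (is "?L \<longleftrightarrow> ?R")
proof
  assume ?L
  then obtain f where f: "f ` pverts H \<subseteq> V" "inj_on f (pverts H)"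
      "\<forall>i \<in> pverts H. \<forall>j \<in> pverts H. (f i, f j) \<in> A \<longleftrightarrow> (i, j) \<in> parcs H"
    by blast
  have nth: "\<forall>i < 5. i \<in> pverts H \<and> [f 0, f 1, f 2, f 3, f 4] ! i = f i"
    unfolding all_less_5 assms by simp
  have dist: "distinct [f 0, f 1, f 2, f 3, f 4]"
    using f(2) assms by (auto simp: inj_on_def)
  have arcs: "\<forall>i < 5. \<forall>j < 5.
      ([f 0, f 1, f 2, f 3, f 4] ! i, [f 0, f 1, f 2, f 3, f 4] ! j) \<in> A \<longleftrightarrow> (i, j) \<in> parcs H"
    using f(3) nth by (metis (no_types))
  have in_V: "f i \<in> V" if "i \<in> {0, 1, 2, 3, 4}" for i
    using f(1) that assms by blast
  show ?R
    by (rule bexI[of _ "f 0"], rule bexI[of _ "f 1"], rule bexI[of _ "f 2"], rule bexI[of _ "f 3"],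
        rule bexI[of _ "f 4"], rule conjI[OF dist arcs]) (rule in_V, simp)+
next
  assume ?R
  then obtain a b c d e where in_V: "a \<in> V" "b \<in> V" "c \<in> V" "d \<in> V" "e \<in> V"
    and dist: "distinct [a, b, c, d, e]"
    and arcs: "\<forall>i < 5. \<forall>j < 5. ([a, b, c, d, e] ! i, [a, b, c, d, e] ! j) \<in> A \<longleftrightarrow> (i, j) \<in> parcs H"
    by blast
  have "i \<in> pverts H \<longleftrightarrow> i < 5" for i
    using assms by auto
  moreover have "inj_on (\<lambda>i. [a, b, c, d, e] ! i) (pverts H)"
    using dist calculation by (intro inj_onI) (simp add: nth_eq_iff_index_eq del: distinct.simps)
  moreover have "(\<lambda>i. [a, b, c, d, e] ! i) ` pverts H \<subseteq> V"
    using in_V assms by auto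
  ultimately show ?L
    using arcs by (intro exI[of _ "\<lambda>i. [a, b, c, d, e] ! i"]) simp
qed

text \<open>In the three patterns an inequality is stated exactly for nonadjacent vertices with the
  same neighbours. Any other two vertices are adjacent or told apart by a third one.\<close>

definition W4_on :: "('a \<Rightarrow> 'a \<Rightarrow> bool) \<Rightarrow> 'a \<Rightarrow> 'a \<Rightarrow> 'a \<Rightarrow> 'a \<Rightarrow> 'a \<Rightarrow> bool" where
  "W4_on E a b c d e \<longleftrightarrow> E a b \<and> E b c \<and> E c d \<and> E d a \<and> E e a \<and> E e b \<and> E e c \<and> E e d \<and>
     \<not> E a c \<and> \<not> E b d \<and> a \<noteq> c \<and> b \<noteq> d"

definition dart_on :: "('a \<Rightarrow> 'a \<Rightarrow> bool) \<Rightarrow> 'a \<Rightarrow> 'a \<Rightarrow> 'a \<Rightarrow> 'a \<Rightarrow> 'a \<Rightarrow> bool" where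
  "dart_on E a b c d e \<longleftrightarrow> E a b \<and> E a c \<and> E a d \<and> E b c \<and> E b d \<and> E e a \<and>
     \<not> E b e \<and> \<not> E c d \<and> \<not> E c e \<and> \<not> E d e \<and> c \<noteq> d"

definition gem_on :: "('a \<Rightarrow> 'a \<Rightarrow> bool) \<Rightarrow> 'a \<Rightarrow> 'a \<Rightarrow> 'a \<Rightarrow> 'a \<Rightarrow> 'a \<Rightarrow> bool" where
  "gem_on E a b c d e \<longleftrightarrow> E a b \<and> E b c \<and> E c d \<and> E e a \<and> E e b \<and> E e c \<and> E e d \<and>
     \<not> E a c \<and> \<not> E a d \<and> \<not> E b d"

lemma W4_on_iff:
  assumes irr: "\<And>v. (v, v) \<notin> A" and sy: "\<And>u v. (u, v) \<in> A \<longleftrightarrow> (v, u) \<in> A"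
  shows "distinct [a, b, c, d, e] \<and> (\<forall>i < 5. \<forall>j < 5.
      ([a, b, c, d, e] ! i, [a, b, c, d, e] ! j) \<in> A \<longleftrightarrow> (i, j) \<in> parcs W4_graph) \<longleftrightarrow>
    W4_on (\<lambda>u v. (u, v) \<in> A) a b c d e"
proof -
  \<comment> \<open>These instances rewrite every pair of vertices into alphabetical order.\<close>
  note swap = sy[of b a] sy[of c a] sy[of d a] sy[of e a] sy[of c b] sy[of d b] sy[of e b]
    sy[of d c] sy[of e c] sy[of e d]
  show ?thesis
    unfolding all_less_5 W4_on_def
    by (simp add: W4_graph_def undirected_def irr swap) (auto simp: irr)
qed

lemma dart_on_iff:
  assumes irr: "\<And>v. (v, v) \<notin> A" and sy: "\<And>u v. (u, v) \<in> A \<longleftrightarrow> (v, u) \<in> A"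
  shows "distinct [a, b, c, d, e] \<and> (\<forall>i < 5. \<forall>j < 5.
      ([a, b, c, d, e] ! i, [a, b, c, d, e] ! j) \<in> A \<longleftrightarrow> (i, j) \<in> parcs dart_graph) \<longleftrightarrow>
    dart_on (\<lambda>u v. (u, v) \<in> A) a b c d e"
proof -
  note swap = sy[of b a] sy[of c a] sy[of d a] sy[of e a] sy[of c b] sy[of d b] sy[of e b]
    sy[of d c] sy[of e c] sy[of e d]
  show ?thesis
    unfolding all_less_5 dart_on_def
    by (simp add: dart_graph_def undirected_def irr swap) (auto simp: irr, (metis sy)+)
qed

lemma gem_on_iff:
  assumes irr: "\<And>v. (v, v) \<notin> A" and sy: "\<And>u v. (u, v) \<in> A \<longleftrightarrow> (v, u) \<in> A"
  shows "distinct [a, b, c, d, e] \<and> (\<forall>i < 5. \<forall>j < 5.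
      ([a, b, c, d, e] ! i, [a, b, c, d, e] ! j) \<in> A \<longleftrightarrow> (i, j) \<in> parcs gem_graph) \<longleftrightarrow>
    gem_on (\<lambda>u v. (u, v) \<in> A) a b c d e"
proof -
  note swap = sy[of b a] sy[of c a] sy[of d a] sy[of e a] sy[of c b] sy[of d b] sy[of e b]
    sy[of d c] sy[of e c] sy[of e d]
  show ?thesis
    unfolding all_less_5 gem_on_def
    by (simp add: gem_graph_def undirected_def irr swap) (auto simp: irr, (metis sy)+)
qed

context pair_graph
begin

lemma adj_sym: "(u, v) \<in> parcs G \<longleftrightarrow> (v, u) \<in> parcs G"
  using pair_sym_arcs by (auto simp: symmetric_def dest: symD)

lemma adj_irrefl: "(v, v) \<notin> parcs G"
  using pair_no_loops by fastforce

lemma W4_dart_gem_free_iff: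
  "W4_dart_gem_free (with_proj G) \<longleftrightarrow>
    (\<forall>a \<in> pverts G. \<forall>b \<in> pverts G. \<forall>c \<in> pverts G. \<forall>d \<in> pverts G. \<forall>e \<in> pverts G.
      \<not> W4_on (\<lambda>u v. (u, v) \<in> parcs G) a b c d e \<and> \<not> dart_on (\<lambda>u v. (u, v) \<in> parcs G) a b c d e \<and>
      \<not> gem_on (\<lambda>u v. (u, v) \<in> parcs G) a b c d e)"
proof -
  have pv: "pverts W4_graph = {0, 1, 2, 3, 4}" "pverts dart_graph = {0, 1, 2, 3, 4}"
    "pverts gem_graph = {0, 1, 2, 3, 4}"
    by (simp_all add: W4_graph_def dart_graph_def gem_graph_def undirected_def)
  have wf: "parcs W4_graph \<subseteq> pverts W4_graph \<times> pverts W4_graph"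
    "parcs dart_graph \<subseteq> pverts dart_graph \<times> pverts dart_graph"
    "parcs gem_graph \<subseteq> pverts gem_graph \<times> pverts gem_graph"
    unfolding W4_graph_def dart_graph_def gem_graph_def
    by (rule parcs_undirected_subset; simp)+
  show ?thesis
    unfolding W4_dart_gem_free_def
      induced_free_pair_iff[where G = G, OF wf(1), unfolded embedding5_iff[OF pv(1)] W4_on_iff[OF adj_irrefl adj_sym]]
      induced_free_pair_iff[where G = G, OF wf(2), unfolded embedding5_iff[OF pv(2)] dart_on_iff[OF adj_irrefl adj_sym]]
      induced_free_pair_iff[where G = G, OF wf(3), unfolded embedding5_iff[OF pv(3)] gem_on_iff[OF adj_irrefl adj_sym]]
    by (simp add: ball_conj_distrib)
qed

end

section \<open>Monochromatic maximal stars\<close>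

definition twins_on :: "'a set \<Rightarrow> ('a \<Rightarrow> 'a \<Rightarrow> bool) \<Rightarrow> 'a \<Rightarrow> 'a \<Rightarrow> bool" where
  "twins_on V E v w \<longleftrightarrow> E v w \<and> (\<forall>b \<in> V. b \<noteq> v \<and> b \<noteq> w \<longrightarrow> (E v b \<longleftrightarrow> E w b))"

text \<open>The neighbours of \<open>v\<close> that can occur as a leaf of a star with centre \<open>v\<close> and at least two leaves.\<close>

definition proper_leaf :: "'a set \<Rightarrow> ('a \<Rightarrow> 'a \<Rightarrow> bool) \<Rightarrow> 'a \<Rightarrow> 'a \<Rightarrow> bool" where
  "proper_leaf V E v a \<longleftrightarrow> E v a \<and> (\<exists>b \<in> V. E v b \<and> b \<noteq> a \<and> \<not> E a b)"

text \<open>In the graphs considered, the second conjunct asks at each centre with proper leaves for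
  one clique of them that misses the colour of the centre; \<open>u\<close> stands for its clique.
  \<open>same\<close> is an arbitrary relation so that it can also mean sharing a listed colour,
  which need not be transitive.\<close>

definition star_condition :: "'a set \<Rightarrow> ('a \<Rightarrow> 'a \<Rightarrow> bool) \<Rightarrow> ('a \<Rightarrow> 'a \<Rightarrow> bool) \<Rightarrow> bool" where
  "star_condition V E same \<longleftrightarrow>
     (\<forall>v \<in> V. \<forall>w \<in> V. twins_on V E v w \<longrightarrow> \<not> same v w) \<and>
     (\<forall>v \<in> V. (\<exists>u \<in> V. proper_leaf V E v u) \<longrightarrow>
        (\<exists>u \<in> V. proper_leaf V E v u \<and>
          (\<forall>w \<in> V. proper_leaf V E v w \<and> same v w \<longrightarrow> w \<noteq> u \<and> \<not> E w u)))"

text \<open>\<open>same\<close> occurs only negatively. This allows passing from overlapping colour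
  classes to a single colour per vertex.\<close>

lemma star_condition_mono:
  assumes "star_condition V E same" "\<And>v w. v \<in> V \<Longrightarrow> w \<in> V \<Longrightarrow> same' v w \<Longrightarrow> same v w"
  shows "star_condition V E same'"
  unfolding star_condition_def
proof (intro conjI ballI impI)
  fix v w assume "v \<in> V" "w \<in> V" "twins_on V E v w"
  then show "\<not> same' v w" using assms unfolding star_condition_def by blast
next
  fix v assume v: "v \<in> V" "\<exists>u \<in> V. proper_leaf V E v u"
  then obtain u where "u \<in> V" "proper_leaf V E v u"
      "\<And>w. w \<in> V \<Longrightarrow> proper_leaf V E v w \<Longrightarrow> same v w \<Longrightarrow> w \<noteq> u \<and> \<not> E w u"
    using assms(1) unfolding star_condition_def by metis
  then show "\<exists>u \<in> V. proper_leaf V E v u \<and>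
      (\<forall>w \<in> V. proper_leaf V E v w \<and> same' v w \<longrightarrow> w \<noteq> u \<and> \<not> E w u)"
    using assms(2) v(1) by blast
qed

section \<open>Stars as a centre with independent leaves\<close>

context pair_graph
begin

abbreviation adj where "adj u v \<equiv> (u, v) \<in> parcs G"

lemma adj_verts: "adj u v \<Longrightarrow> u \<in> pverts G \<and> v \<in> pverts G"
  using in_arcsD1 in_arcsD2 by blast

text \<open>With a single leaf either endpoint can serve as the centre, so maximality has to be
  tested against stars with any centre.\<close>

definition star_at :: "'a \<Rightarrow> 'a set \<Rightarrow> bool" where
  "star_at v I \<longleftrightarrow> I \<noteq> {} \<and> (\<forall>a \<in> I. adj v a) \<and> (\<forall>a \<in> I. \<forall>b \<in> I. \<not> adj a b)"

lemma is_star_iff: "is_star (with_proj G) W \<longleftrightarrow> (\<exists>v I. W = insert v I \<and> star_at v I)"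
proof
  assume "is_star (with_proj G) W"
  then obtain m where W: "W \<subseteq> pverts G" "m \<ge> 1" "complete_bipartite_digraph 1 m (with_proj G \<restriction> W)"
    by (auto simp: is_star_def)
  then obtain U I where UI: "W = U \<union> I" "U \<inter> I = {}" "card U = 1" "card I = m"
      "arcs_ends (with_proj G \<restriction> W) = U \<times> I \<union> I \<times> U"
    unfolding complete_bipartite_digraph_def by auto
  obtain v where v: "U = {v}"
    using UI(3) by (auto simp: card_1_singleton_iff)
  have arcs: "arcs_ends (with_proj G \<restriction> W) = {(a, b). adj a b \<and> a \<in> W \<and> b \<in> W}"
    by (auto simp: arcs_ends_conv induce_subgraph_def)
  have *: "adj a b \<longleftrightarrow> (a, b) \<in> U \<times> I \<union> I \<times> U" if "a \<in> W" "b \<in> W" for a b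
    using that UI(5) unfolding arcs by blast
  have "star_at v I"
    unfolding star_at_def
  proof (intro conjI ballI)
    show "I \<noteq> {}" using UI(4) W(2) by auto
    show "adj v a" if "a \<in> I" for a
      using *[of v a] UI(1) v that by blast
    show "\<not> adj a b" if "a \<in> I" "b \<in> I" for a b
      using *[of a b] UI(1,2) v that by blast
  qed
  then show "\<exists>v I. W = insert v I \<and> star_at v I"
    using UI(1) v by auto
next
  assume "\<exists>v I. W = insert v I \<and> star_at v I"
  then obtain v I where W: "W = insert v I" "star_at v I" by blast
  have sub: "W \<subseteq> pverts G"
    using W adj_verts unfolding star_at_def by blast
  have "finite I"
    using sub W(1) pair_finite_verts finite_subset by fastforce
  then have "card I \<ge> 1"
    using W(2) by (auto simp: star_at_def Suc_le_eq card_gt_0_iff)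
  moreover have "complete_bipartite_digraph 1 (card I) (with_proj G \<restriction> W)"
  proof -
    let ?H = "\<lparr>pverts = W, parcs = {e \<in> parcs G. fst e \<in> W \<and> snd e \<in> W}\<rparr>"
    have eq: "with_proj G \<restriction> W = with_proj ?H"
      by (simp add: induce_subgraph_def with_proj_def)
    have "v \<notin> I"
      using W(2) adj_irrefl by (auto simp: star_at_def)
    moreover have "parcs ?H = {v} \<times> I \<union> I \<times> {v}"
    proof (intro equalityI subsetI)
      fix e assume "e \<in> parcs ?H"
      then show "e \<in> {v} \<times> I \<union> I \<times> {v}"
        using W adj_irrefl by (cases e) (auto simp: star_at_def)
    next
      fix e assume "e \<in> {v} \<times> I \<union> I \<times> {v}"
      then obtain a where a: "a \<in> I" "e = (v, a) \<or> e = (a, v)" by auto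
      then have "adj v a" "adj a v" using W(2) adj_sym by (auto simp: star_at_def)
      then show "e \<in> parcs ?H" using a W(1) by auto
    qed
    ultimately have "finite (pverts ?H) \<and> pverts ?H = {v} \<union> I \<and> {v} \<inter> I = {} \<and> card {v} = 1 \<and>
        card I = card I \<and> parcs ?H = {v} \<times> I \<union> I \<times> {v}"
      using W(1) \<open>finite I\<close> by simp
    then show ?thesis
      unfolding eq complete_bipartite_digraph_pair_def by blast
  qed
  ultimately show "is_star (with_proj G) W"
    unfolding is_star_def using sub by auto
qed

lemma is_maximal_star_iff:
  "is_maximal_star (with_proj G) W \<longleftrightarrow> (\<exists>v I. W = insert v I \<and> star_at v I) \<and>
     (\<forall>c J. star_at c J \<and> W \<subseteq> insert c J \<longrightarrow> insert c J = W)"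
  unfolding is_maximal_star_def is_star_iff by blast

text \<open>
  Three leaves \<open>a\<close>, \<open>b\<close>, \<open>c\<close> violating the claim and a neighbour of \<open>v\<close> that is not adjacent to \<open>b\<close>
  span, together with \<open>v\<close>, a dart, a gem or \<open>W\<^sub>4\<close>. Hence the proper leaves at \<open>v\<close> form disjoint cliques.
\<close>

lemma proper_leaf_trans:
  assumes free: "W4_dart_gem_free (with_proj G)"
    and leaf: "proper_leaf (pverts G) adj v b"
    and nb: "adj v a" "adj v c" and ab: "adj a b" and bc: "adj b c" and ac: "a \<noteq> c"
  shows "adj a c"
proof (rule ccontr)
  assume nac: "\<not> adj a c"
  obtain d where d: "adj v d" "d \<noteq> b" "\<not> adj b d" "adj v b"
    using leaf unfolding proper_leaf_def by blast
  have V: "v \<in> pverts G" "a \<in> pverts G" "b \<in> pverts G" "c \<in> pverts G" "d \<in> pverts G"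
    using d nb ab adj_verts by blast+
  note no = free[unfolded W4_dart_gem_free_iff, rule_format]
  \<comment> \<open>The cases are the neighbours of \<open>d\<close> among \<open>a\<close> and
    \<open>c\<close>: both give \<open>W4\<close> with hub \<open>v\<close>, none gives a dart whose
    pendant vertex \<open>d\<close> hangs at \<open>v\<close>, and exactly one gives a gem with hub
    \<open>v\<close>.\<close>
  have "\<not> W4_on adj a b c d v" "\<not> dart_on adj v b a c d"
    "\<not> gem_on adj a b c d v" "\<not> gem_on adj c b a d v"
    using no V by blast+
  moreover have "adj d a \<longleftrightarrow> adj a d" "adj d c \<longleftrightarrow> adj c d" "adj b a" "adj c b" "adj d v"
      "\<not> adj c a" "\<not> adj d b"
    using adj_sym ab bc d nac by blast+
  ultimately show False
    using d nb ab bc ac nac by (auto simp: W4_on_def dart_on_def gem_on_def)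
qed

text \<open>A maximal star with one leaf is a pair of twins, as a private neighbour of either end
  would extend it. With more leaves, every proper leaf of the centre equals or is adjacent to a leaf
  of the star, since it could be added otherwise; that leaf has the colour of the centre.\<close>

lemma maximal_star_imp_violation:
  assumes max: "is_maximal_star (with_proj G) W" and mono: "\<And>a b. a \<in> W \<Longrightarrow> b \<in> W \<Longrightarrow> \<rho> a = \<rho> b"
  shows "\<not> star_condition (pverts G) adj (\<lambda>v w. \<rho> v = \<rho> w)"
proof -
  obtain v I where W: "W = insert v I" and star: "star_at v I"
    using max by (auto simp: is_maximal_star_iff)
  have maxD: "insert c J = W" if "star_at c J" "W \<subseteq> insert c J" for c J
    using max that by (auto simp: is_maximal_star_iff)
  have I: "adj v a" if "a \<in> I" for a
    using star that by (auto simp: star_at_def)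
  have indep: "\<not> adj a b" if "a \<in> I" "b \<in> I" for a b
    using star that by (auto simp: star_at_def)
  obtain w where w: "w \<in> I"
    using star by (auto simp: star_at_def)
  have v: "v \<in> pverts G" "w \<in> pverts G" using I w adj_verts by blast+
  show ?thesis
  proof (cases "I = {w}")
    case True
    have "twins_on (pverts G) adj v w"
      unfolding twins_on_def
    proof (intro conjI ballI impI)
      show "adj v w" using I w .
      fix b assume b: "b \<noteq> v \<and> b \<noteq> w"
      have "False" if "adj v b" "\<not> adj w b"
      proof -
        have "star_at v {w, b}"
          using that I[OF w] adj_irrefl adj_sym by (auto simp: star_at_def)
        from maxD[OF this] show False using True W b by auto
      qed
      moreover have "False" if "adj w b" "\<not> adj v b"
      proof -
        have "star_at w {v, b}"
          using that I[OF w] adj_irrefl adj_sym by (auto simp: star_at_def)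
        from maxD[OF this] show False using True W b by auto
      qed
      ultimately show "adj v b \<longleftrightarrow> adj w b" by blast
    qed
    then show ?thesis
      using v mono[of v w] W w unfolding star_condition_def by blast
  next
    case False
    have leaf: "proper_leaf (pverts G) adj v a" if a: "a \<in> I" for a
    proof -
      obtain b where "b \<in> I" "b \<noteq> a" using False w a by blast
      then show ?thesis
        unfolding proper_leaf_def using I indep a adj_verts by blast
    qed
    have "\<exists>w \<in> pverts G. proper_leaf (pverts G) adj v w \<and> \<rho> v = \<rho> w \<and> (w = u \<or> adj w u)"
      if u: "proper_leaf (pverts G) adj v u" for u
    proof -
      have "\<exists>i \<in> I. i = u \<or> adj i u"
      proof (rule ccontr)
        assume no: "\<not> (\<exists>i \<in> I. i = u \<or> adj i u)"
        have "adj v u" using u by (simp add: proper_leaf_def)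
        then have "star_at v (insert u I)"
          using star no adj_irrefl adj_sym by (auto simp: star_at_def)
        then have "insert v (insert u I) = W"
          using W by (intro maxD) blast+
        moreover have "u \<noteq> v" using \<open>adj v u\<close> adj_irrefl by blast
        ultimately show False
          using no W by blast
      qed
      then obtain i where i: "i \<in> I" "i = u \<or> adj i u" by blast
      moreover have "\<rho> v = \<rho> i" using mono[of v i] W i(1) by blast
      moreover have "i \<in> pverts G" using I[OF i(1)] adj_verts by blast
      ultimately show ?thesis
        using leaf by blast
    qed
    then show ?thesis
      using leaf[OF w] v unfolding star_condition_def by blast
  qed
qed

text \<open>Adjacent \<open>v\<close> and \<open>w\<close> cannot both be leaves, so one of them is
  the centre of a larger star. A further leaf is adjacent to the centre, hence to its twin, which is
  a leaf too.\<close>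

lemma twins_maximal_star:
  assumes "twins_on (pverts G) adj v w"
  shows "is_maximal_star (with_proj G) {v, w}"
proof -
  have vw: "adj v w" "adj w v" and tw: "\<And>b. b \<noteq> v \<Longrightarrow> b \<noteq> w \<Longrightarrow> adj v b \<longleftrightarrow> adj w b"
    using assms adj_sym adj_verts unfolding twins_on_def by blast+
  have "star_at v {w}"
    using vw adj_irrefl by (auto simp: star_at_def)
  moreover have "insert c J = {v, w}" if J: "star_at c J" "{v, w} \<subseteq> insert c J" for c J
  proof (rule ccontr)
    assume "insert c J \<noteq> {v, w}"
    then obtain x where x: "x \<in> insert c J" "x \<noteq> v" "x \<noteq> w" using J(2) by blast
    then have "adj v x \<longleftrightarrow> adj w x" using tw by blast
    moreover have "\<not> adj a b" if "a \<in> J" "b \<in> J" for a b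
      using J(1) that by (auto simp: star_at_def)
    moreover have "a \<in> J \<Longrightarrow> adj c a" for a
      using J(1) by (auto simp: star_at_def)
    ultimately show False
      using x J(2) vw adj_irrefl by (cases "c = v"; cases "c = w") auto
  qed
  ultimately show ?thesis
    unfolding is_maximal_star_iff by blast
qed

text \<open>A maximal independent set \<open>I\<close> of proper leaves in the colour of
  \<open>v\<close> works. By maximality it dominates the proper leaves of this colour, and by
  \<open>proper_leaf_trans\<close> it then dominates all of them. Any leaf added to the star would
  be a proper leaf, hence adjacent to some vertex of \<open>I\<close>.\<close>

lemma leaves_maximal_star:
  assumes free: "W4_dart_gem_free (with_proj G)"
    and u0: "proper_leaf (pverts G) adj v u0"
    and cover: "\<And>u. proper_leaf (pverts G) adj v u \<Longrightarrow>
      \<exists>w. proper_leaf (pverts G) adj v w \<and> \<rho> v = \<rho> w \<and> (w = u \<or> adj w u)"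
  shows "\<exists>W. is_maximal_star (with_proj G) W \<and> (\<forall>a \<in> W. \<rho> a = \<rho> v)"
proof -
  let ?H = "proper_leaf (pverts G) adj v"
  \<comment> \<open>The vertex witnessing that \<open>a\<close> is a proper leaf is itself one,
    witnessed by \<open>a\<close>.\<close>
  have H: "adj v a" "\<exists>b. ?H b \<and> b \<noteq> a \<and> \<not> adj a b" if "?H a" for a
    using that adj_sym adj_verts unfolding proper_leaf_def by blast+
  define C where "C = {a. ?H a \<and> \<rho> v = \<rho> a}"
  define F where "F = {I. I \<subseteq> C \<and> (\<forall>a \<in> I. \<forall>b \<in> I. \<not> adj a b)}"
  have "C \<subseteq> pverts G"
    using H(1) adj_verts by (auto simp: C_def)
  then have "finite F"
    using pair_finite_verts by (intro finite_subset[of F "Pow (pverts G)"]) (auto simp: F_def)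
  moreover have "F \<noteq> {}" unfolding F_def by blast
  ultimately obtain I where I: "I \<in> F" and Imax: "\<And>J. J \<in> F \<Longrightarrow> I \<subseteq> J \<Longrightarrow> J = I"
    using finite_has_maximal[of F] by metis
  have IC: "?H a" "\<rho> a = \<rho> v" if "a \<in> I" for a
    using I that by (auto simp: F_def C_def)
  have indep: "\<not> adj a b" if "a \<in> I" "b \<in> I" for a b
    using I that by (auto simp: F_def)
  have domC: "\<exists>i \<in> I. i = w \<or> adj i w" if "w \<in> C" for w
  proof (rule ccontr)
    assume no: "\<not> (\<exists>i \<in> I. i = w \<or> adj i w)"
    then have "insert w I \<in> F"
      using I that adj_irrefl adj_sym by (auto simp: F_def)
    from Imax[OF this] no show False by blast
  qed
  have dom: "\<exists>i \<in> I. i = u \<or> adj i u" if u: "?H u" for u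
  proof -
    obtain w where w: "?H w" "\<rho> v = \<rho> w" "w = u \<or> adj w u" using cover[OF u] by blast
    then obtain i where i: "i \<in> I" "i = w \<or> adj i w" using domC by (auto simp: C_def)
    show ?thesis
    proof (cases "i = w \<or> w = u \<or> i = u")
      case False
      then have "adj i u"
        using proper_leaf_trans[OF free w(1), of i u] w i u H(1) IC(1) by blast
      then show ?thesis using i(1) by blast
    qed (use w i in blast)
  qed
  \<comment> \<open>A common dominator of \<open>u0\<close> and its non-neighbour \<open>b0\<close>
    would make them adjacent. So \<open>I\<close> has two elements, which forces the centre of any
    star containing \<open>insert v I\<close> to be \<open>v\<close>.\<close>
  obtain b0 where b0: "?H b0" "b0 \<noteq> u0" "\<not> adj u0 b0" using H(2)[OF u0] by blast
  obtain i where i: "i \<in> I" "i = u0 \<or> adj i u0" using dom[OF u0] by blast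
  obtain j where j: "j \<in> I" "j = b0 \<or> adj j b0" using dom[OF b0(1)] by blast
  have "i \<noteq> j"
  proof
    assume "i = j"
    moreover have "\<not> adj b0 u0" using b0(3) adj_sym by blast
    ultimately have "adj i u0" "adj i b0" using i(2) j(2) b0 by blast+
    then have "adj u0 b0"
      using proper_leaf_trans[OF free IC(1)[OF i(1)], of u0 b0] H(1) u0 b0 adj_sym by blast
    then show False using b0(3) by blast
  qed
  have star: "star_at v I"
    using i(1) H(1) IC(1) indep by (auto simp: star_at_def)
  have "insert c J = insert v I" if J: "star_at c J" "insert v I \<subseteq> insert c J" for c J
  proof -
    have Jindep: "\<not> adj a b" if "a \<in> J" "b \<in> J" for a b
      using J(1) that by (auto simp: star_at_def)
    have "c = v"
    proof (rule ccontr)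
      assume "c \<noteq> v"
      then have "v \<in> J" using J(2) by blast
      moreover have "i \<in> J \<or> j \<in> J" using \<open>i \<noteq> j\<close> i(1) j(1) J(2) by blast
      ultimately show False
        using Jindep H(1) IC(1) i(1) j(1) by blast
    qed
    have "v \<notin> I" using H(1) IC(1) adj_irrefl by blast
    then have IJ: "I \<subseteq> J" using J(2) \<open>c = v\<close> by blast
    have "x \<in> I" if x: "x \<in> J" for x
    proof (rule ccontr)
      assume "x \<notin> I"
      have "adj v x" using J(1) x \<open>c = v\<close> by (auto simp: star_at_def)
      then have "?H x"
        unfolding proper_leaf_def using x IJ i(1) Jindep H(1) IC(1) adj_verts \<open>x \<notin> I\<close> by blast
      then show False using dom IJ Jindep x \<open>x \<notin> I\<close> by blast
    qed
    then show ?thesis using \<open>c = v\<close> IJ by blast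
  qed
  then have "is_maximal_star (with_proj G) (insert v I)"
    unfolding is_maximal_star_iff using star by blast
  then show ?thesis using IC(2) by blast
qed

theorem star_coloring_iff:
  assumes free: "W4_dart_gem_free (with_proj G)"
  shows "is_star_coloring k (with_proj G) \<rho> \<longleftrightarrow>
    is_coloring k (with_proj G) \<rho> \<and> star_condition (pverts G) adj (\<lambda>v w. \<rho> v = \<rho> w)"
proof -
  have mono: "monochromatic \<rho> W \<longleftrightarrow> (\<forall>a \<in> W. \<forall>b \<in> W. \<rho> a = \<rho> b)" if W: "W \<noteq> {}" for W
  proof -
    obtain w where "w \<in> W" using W by blast
    show ?thesis
    proof
      assume "monochromatic \<rho> W"
      then obtain x where x: "\<rho> ` W = {x}"
        by (auto simp: monochromatic_def card_1_singleton_iff)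
      have "\<rho> a = x" if "a \<in> W" for a
        using imageI[OF that, of \<rho>] unfolding x by simp
      then show "\<forall>a \<in> W. \<forall>b \<in> W. \<rho> a = \<rho> b" by metis
    next
      assume "\<forall>a \<in> W. \<forall>b \<in> W. \<rho> a = \<rho> b"
      then have "\<rho> ` W \<subseteq> {\<rho> w}" "{\<rho> w} \<subseteq> \<rho> ` W" using \<open>w \<in> W\<close> by blast+
      then have "\<rho> ` W = {\<rho> w}" by blast
      then show "monochromatic \<rho> W" by (simp add: monochromatic_def)
    qed
  qed
  have ne: "W \<noteq> {}" if "is_maximal_star (with_proj G) W" for W
    using that by (auto simp: is_maximal_star_iff)
  have "(\<exists>W. is_maximal_star (with_proj G) W \<and> monochromatic \<rho> W) \<longleftrightarrow>
      \<not> star_condition (pverts G) adj (\<lambda>v w. \<rho> v = \<rho> w)" (is "?L \<longleftrightarrow> \<not> ?R")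
  proof
    assume ?L
    then obtain W where W: "is_maximal_star (with_proj G) W" "monochromatic \<rho> W" by blast
    then have "\<forall>a \<in> W. \<forall>b \<in> W. \<rho> a = \<rho> b" using mono[OF ne] by blast
    then show "\<not> ?R" using maximal_star_imp_violation[OF W(1)] by blast
  next
    assume "\<not> ?R"
    then consider v w where "twins_on (pverts G) adj v w" "\<rho> v = \<rho> w"
      | v u0 where "proper_leaf (pverts G) adj v u0"
          "\<And>u. u \<in> pverts G \<Longrightarrow> proper_leaf (pverts G) adj v u \<Longrightarrow>
            \<exists>w. proper_leaf (pverts G) adj v w \<and> \<rho> v = \<rho> w \<and> (w = u \<or> adj w u)"
      unfolding star_condition_def de_Morgan_conj not_all by (elim disjE) blast+
    then show ?L
    proof cases
      case 1
      from twins_maximal_star[OF this(1)] show ?thesis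
        using 1 mono[of "{v, w}"] by auto
    next
      case 2
      have "\<exists>W. is_maximal_star (with_proj G) W \<and> (\<forall>a \<in> W. \<rho> a = \<rho> v)"
        by (rule leaves_maximal_star[OF free 2(1)])
           (use 2(2) adj_verts in \<open>auto simp: proper_leaf_def\<close>)
      then obtain W where "is_maximal_star (with_proj G) W" "\<forall>a \<in> W. \<rho> a = \<rho> v" by blast
      then show ?thesis using mono[OF ne] by auto
    qed
  qed
  then show ?thesis
    unfolding is_star_coloring_def by blast
qed

end

section \<open>A certificate for connectedness\<close>

text \<open>
  A graph is connected if and only if its vertices admit a strict partial order in which every
  vertex except a root has a smaller neighbour: compare distances from the root.
\<close>

context pair_graph
begin

text \<open>A strict order on a finite set is well founded, so passing to smaller neighbours ends in
  \<open>r\<close>.\<close>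

lemma connected_if_order:
  fixes prec :: "'a \<Rightarrow> 'a \<Rightarrow> bool"
  assumes r: "r \<in> pverts G"
    and irrefl: "\<And>i. i \<in> pverts G \<Longrightarrow> \<not> prec i i"
    and trans: "\<And>i j l. i \<in> pverts G \<Longrightarrow> j \<in> pverts G \<Longrightarrow> l \<in> pverts G \<Longrightarrow>
      prec i j \<Longrightarrow> prec j l \<Longrightarrow> prec i l"
    and pred: "\<And>i. i \<in> pverts G \<Longrightarrow> i \<noteq> r \<Longrightarrow> \<exists>j \<in> pverts G. prec j i \<and> adj i j"
  shows "Digraph_Component.connected (with_proj G)"
proof -
  let ?R = "{(i, j). i \<in> pverts G \<and> j \<in> pverts G \<and> prec i j}"
  have "trans ?R"
    using trans by (auto intro!: transI)
  then have "acyclic ?R"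
    using irrefl by (auto simp: acyclic_def)
  moreover have "finite ?R"
    by (rule finite_subset[of _ "pverts G \<times> pverts G"]) (auto simp: pair_finite_verts)
  ultimately have wf: "wf ?R"
    by (simp add: finite_acyclic_wf)
  have reach: "i \<rightarrow>\<^sup>*\<^bsub>with_proj G\<^esub> r" if "i \<in> pverts G" for i
    using that
  proof (induction i rule: wf_induct_rule[OF wf])
    case (1 i)
    show ?case
    proof (cases "i = r")
      case False
      then obtain j where j: "j \<in> pverts G" "prec j i" "adj i j" using pred 1 by blast
      then have "j \<rightarrow>\<^sup>*\<^bsub>with_proj G\<^esub> r" using 1 by auto
      then show ?thesis using j(3) adj_reachable_trans by auto
    qed (use r in auto)
  qed
  have "i \<rightarrow>\<^sup>*\<^bsub>with_proj G\<^esub> j" if "i \<in> pverts G" "j \<in> pverts G" for i j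
    using reach that symmetric_reachable' reachable_trans by meson
  then have "i \<rightarrow>\<^sup>*\<^bsub>with_proj (mk_symmetric (with_proj G))\<^esub> j" if "i \<in> pverts G" "j \<in> pverts G" for i j
    using that reachable_mk_symmetricI by blast
  then show ?thesis
    unfolding connected_def strongly_connected_def using r by (auto simp: mk_symmetric_def)
qed

lemma order_if_connected:
  assumes conn: "Digraph_Component.connected (with_proj G)" and r: "r \<in> pverts G"
  obtains d :: "'a \<Rightarrow> nat" where
    "\<And>i. i \<in> pverts G \<Longrightarrow> i \<noteq> r \<Longrightarrow> \<exists>j \<in> pverts G. d j < d i \<and> adj i j"
proof
  \<comment> \<open>The distance from the root; the vertex before \<open>i\<close> on a shortest
    walk is the neighbour sought.\<close>
  define d where "d i = (LEAST m. (r, i) \<in> parcs G ^^ m)" for i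
  fix i assume i: "i \<in> pverts G" "i \<noteq> r"
  have "r \<rightarrow>\<^sup>*\<^bsub>with_proj G\<^esub> i"
    using symmetric_connected_imp_strongly_connected[OF pair_sym_arcs conn] i r
    by (auto simp: strongly_connected_def)
  then have "(r, i) \<in> (parcs G)\<^sup>*"
    using reachable_rtranclI by fastforce
  then have "\<exists>m. (r, i) \<in> parcs G ^^ m"
    by (rule rtrancl_imp_relpow)
  then have di: "(r, i) \<in> parcs G ^^ d i"
    unfolding d_def by (rule LeastI_ex)
  then obtain m where m: "d i = Suc m"
    using i(2) by (cases "d i") auto
  then obtain j where j: "(r, j) \<in> parcs G ^^ m" "adj j i"
    using di by auto
  have "d j \<le> m"
    unfolding d_def using j(1) by (rule Least_le)
  then show "\<exists>j \<in> pverts G. (LEAST m. (r, j) \<in> parcs G ^^ m) < (LEAST m. (r, i) \<in> parcs G ^^ m) \<and> adj i j"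
    using m j(2) adj_sym adj_verts unfolding d_def by (metis le_imp_less_Suc)
qed

end

section \<open>The verifier\<close>

text \<open>Arbitrary relations allow one predicate to speak about graphs, matrices and bits of a
  word. Vertex 0 is the root. Colours are counted from 0 here but from 1 in
  \<open>is_coloring\<close>, whence the shifts by \<open>Suc\<close>.\<close>

definition verified ::
    "nat \<Rightarrow> nat \<Rightarrow> (nat \<Rightarrow> nat \<Rightarrow> bool) \<Rightarrow> (nat \<Rightarrow> nat \<Rightarrow> bool) \<Rightarrow> (nat \<Rightarrow> nat \<Rightarrow> bool) \<Rightarrow> bool" where
  "verified k n E prec col \<longleftrightarrow>
     0 < n \<and>
     (\<forall>i < n. \<not> E i i) \<and> (\<forall>i < n. \<forall>j < n. E i j \<longrightarrow> E j i) \<and>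
     (\<forall>i < n. \<not> prec i i) \<and>
     (\<forall>i < n. \<forall>j < n. \<forall>l < n. prec i j \<and> prec j l \<longrightarrow> prec i l) \<and>
     (\<forall>i < n. i \<noteq> 0 \<longrightarrow> (\<exists>j < n. prec j i \<and> E i j)) \<and>
     (\<forall>a < n. \<forall>b < n. \<forall>c < n. \<forall>d < n. \<forall>e < n.
        \<not> W4_on E a b c d e \<and> \<not> dart_on E a b c d e \<and> \<not> gem_on E a b c d e) \<and>
     (\<forall>i < n. \<exists>c < k. col c i) \<and>
     star_condition {..<n} E (\<lambda>v w. \<exists>c < k. col c v \<and> col c w)"

lemma star_condition_cong:
  assumes "\<And>v w. v \<in> V \<Longrightarrow> w \<in> V \<Longrightarrow> E v w \<longleftrightarrow> E' v w"
    and "\<And>v w. v \<in> V \<Longrightarrow> w \<in> V \<Longrightarrow> same v w \<longleftrightarrow> same' v w"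
  shows "star_condition V E same \<longleftrightarrow> star_condition V E' same'"
  unfolding star_condition_def twins_on_def proper_leaf_def
  using assms by (simp cong: ball_cong bex_cong)

lemma verifiedD:
  assumes "verified k n E prec col"
  shows "0 < n" "\<forall>i < n. \<not> E i i" "\<forall>i < n. \<forall>j < n. E i j \<longrightarrow> E j i" "\<forall>i < n. \<not> prec i i"
    "\<forall>i < n. \<forall>j < n. \<forall>l < n. prec i j \<and> prec j l \<longrightarrow> prec i l"
    "\<forall>i < n. i \<noteq> 0 \<longrightarrow> (\<exists>j < n. prec j i \<and> E i j)"
    "\<forall>a < n. \<forall>b < n. \<forall>c < n. \<forall>d < n. \<forall>e < n.
        \<not> W4_on E a b c d e \<and> \<not> dart_on E a b c d e \<and> \<not> gem_on E a b c d e"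
    "\<forall>i < n. \<exists>c < k. col c i"
    "star_condition {..<n} E (\<lambda>v w. \<exists>c < k. col c v \<and> col c w)"
  using assms unfolding verified_def by - (elim conjE, assumption)+

text \<open>All quantifiers range below \<open>n\<close> or \<open>k\<close>. Outside this range a
  matrix stored in a word yields unrelated bits.\<close>

lemma verified_cong:
  assumes E: "\<And>i j. i < n \<Longrightarrow> j < n \<Longrightarrow> E i j \<longleftrightarrow> E' i j"
    and prec: "\<And>i j. i < n \<Longrightarrow> j < n \<Longrightarrow> prec i j \<longleftrightarrow> prec' i j"
    and col: "\<And>c i. c < k \<Longrightarrow> i < n \<Longrightarrow> col c i \<longleftrightarrow> col' c i"
    and ver: "verified k n E prec col"
  shows "verified k n E' prec' col'"
proof -
  note v = verifiedD[OF ver]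
  show ?thesis
    unfolding verified_def
  proof (intro conjI allI impI)
    fix i j l assume i: "i < n" and j: "j < n" and l: "l < n"
    show "\<not> E' i i" using v(2) E i by blast
    show "E' i j \<Longrightarrow> E' j i" using v(3) E i j by blast
    show "\<not> prec' i i" using v(4) prec i by blast
    show "i \<noteq> 0 \<Longrightarrow> \<exists>j < n. prec' j i \<and> E' i j" using v(6) E prec i by blast
    show "\<exists>c < k. col' c i" using v(8) col i by blast
    assume "prec' i j \<and> prec' j l"
    then have "prec i j \<and> prec j l" using prec i j l by simp
    then have "prec i l" using v(5) i j l by blast
    then show "prec' i l" using prec i l by simp
  next
    fix a b c d e assume lt: "a < n" "b < n" "c < n" "d < n" "e < n"
    have "\<not> W4_on E a b c d e" "\<not> dart_on E a b c d e" "\<not> gem_on E a b c d e"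
      using v(7)[rule_format, OF lt] by blast+
    then show "\<not> W4_on E' a b c d e" "\<not> dart_on E' a b c d e" "\<not> gem_on E' a b c d e"
      using lt by (simp_all add: W4_on_def dart_on_def gem_on_def E)
  next
    have "star_condition {..<n} E (\<lambda>v w. \<exists>c < k. col c v \<and> col c w) \<longleftrightarrow>
        star_condition {..<n} E' (\<lambda>v w. \<exists>c < k. col' c v \<and> col' c w)"
    proof (rule star_condition_cong)
      show "E v w \<longleftrightarrow> E' v w" if "v \<in> {..<n}" "w \<in> {..<n}" for v w
        using E that by simp
      show "(\<exists>c < k. col c v \<and> col c w) \<longleftrightarrow> (\<exists>c < k. col' c v \<and> col' c w)"
        if "v \<in> {..<n}" "w \<in> {..<n}" for v w
        using col[of _ v] col[of _ w] that unfolding lessThan_iff by blast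
    qed
    then show "star_condition {..<n} E' (\<lambda>v w. \<exists>c < k. col' c v \<and> col' c w)"
      using v(9) by blast
  qed (rule v(1))
qed

definition graph_of :: "nat \<Rightarrow> (nat \<Rightarrow> nat \<Rightarrow> bool) \<Rightarrow> nat pair_pre_digraph" where
  "graph_of n E = \<lparr>pverts = {..<n}, parcs = {(i, j). i < n \<and> j < n \<and> E i j}\<rparr>"

lemma verified_sound:
  assumes ver: "verified k n E prec col"
  defines "G \<equiv> graph_of n E"
  shows "pair_graph G" "Digraph_Component.connected (with_proj G)"
    "W4_dart_gem_free (with_proj G)" "\<exists>\<rho>. is_star_coloring k (with_proj G) \<rho>"
proof -
  have [simp]: "pverts G = {..<n}" "(i, j) \<in> parcs G \<longleftrightarrow> i < n \<and> j < n \<and> E i j" for i j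
    by (simp_all add: G_def graph_of_def)
  have "finite (parcs G)"
    by (rule finite_subset[of _ "{..<n} \<times> {..<n}"]) auto
  moreover have "sym (parcs G)"
    using verifiedD(3)[OF ver] by (intro symI) simp
  ultimately show pg: "pair_graph G"
    using verifiedD(2)[OF ver] by unfold_locales (auto simp: symmetric_def)
  then interpret pair_graph G .
  have "verified k n adj prec col"
    by (rule verified_cong[OF _ _ _ ver]) auto
  note v = verifiedD[OF this]
  show "Digraph_Component.connected (with_proj G)"
  proof (rule connected_if_order[of 0 prec])
    show "\<not> prec i i" if "i \<in> pverts G" for i
      using v(4) that by simp
    show "prec i l" if "i \<in> pverts G" "j \<in> pverts G" "l \<in> pverts G" "prec i j" "prec j l" for i j l
      using v(5)[rule_format, of i j l] that by simp
    show "\<exists>j \<in> pverts G. prec j i \<and> adj i j" if "i \<in> pverts G" "i \<noteq> 0" for i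
      using v(6)[rule_format, of i] that by auto
  qed (use v(1) in simp)
  show free: "W4_dart_gem_free (with_proj G)"
    unfolding W4_dart_gem_free_iff using v(7) by simp
  \<comment> \<open>One of possibly several listed colours is chosen;
    \<open>star_condition_mono\<close> justifies the choice.\<close>
  define \<rho> where "\<rho> i = Suc (SOME c. c < k \<and> col c i)" for i
  have \<rho>: "\<exists>c < k. \<rho> i = Suc c \<and> col c i" if "i < n" for i
  proof -
    have "\<exists>c. c < k \<and> col c i" using v(8) that by blast
    from someI_ex[OF this] show ?thesis unfolding \<rho>_def by blast
  qed
  have "is_coloring k (with_proj G) \<rho>"
    unfolding is_coloring_def using \<rho> by fastforce
  moreover have "star_condition (pverts G) adj (\<lambda>v w. \<rho> v = \<rho> w)"
  proof (rule star_condition_mono)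
    show "star_condition (pverts G) adj (\<lambda>v w. \<exists>c < k. col c v \<and> col c w)"
      using v(9) by simp
    show "\<exists>c < k. col c v \<and> col c w" if "v \<in> pverts G" "w \<in> pverts G" "\<rho> v = \<rho> w" for v w
      using \<rho>[of v] \<rho>[of w] that by auto
  qed
  ultimately show "\<exists>\<rho>. is_star_coloring k (with_proj G) \<rho>"
    using star_coloring_iff[OF free] by blast
qed

lemma verified_complete:
  assumes "pair_graph G" and V: "pverts G = {..<n}"
    and conn: "Digraph_Component.connected (with_proj G)"
    and free: "W4_dart_gem_free (with_proj G)"
    and col: "is_star_coloring k (with_proj G) \<rho>"
  shows "\<exists>prec col. verified k n (\<lambda>i j. (i, j) \<in> parcs G) prec col"
proof -
  interpret pair_graph G by fact
  \<comment> \<open>Connectedness includes that there is a vertex, so 0 is available as the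
    root.\<close>
  have n: "0 < n"
    using conn V by (auto simp: connected_def strongly_connected_def mk_symmetric_def)
  then have "0 \<in> pverts G" using V by simp
  from order_if_connected[OF conn this] obtain d :: "nat \<Rightarrow> nat" where
      d: "\<And>i. i \<in> pverts G \<Longrightarrow> i \<noteq> 0 \<Longrightarrow> \<exists>j \<in> pverts G. d j < d i \<and> adj i j"
    by blast
  have \<rho>: "\<exists>c < k. \<rho> i = Suc c" if "i < n" for i
  proof -
    have "\<rho> i \<in> {1..k}"
      using col that V unfolding is_star_coloring_def is_coloring_def with_proj_simps by blast
    then show ?thesis by (intro exI[of _ "\<rho> i - 1"]) auto
  qed
  have "star_condition {..<n} adj (\<lambda>v w. \<rho> v = \<rho> w)"
    using col star_coloring_iff[OF free] V by simp
  then have "star_condition {..<n} adj (\<lambda>v w. \<exists>c < k. \<rho> v = Suc c \<and> \<rho> w = Suc c)"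
    by (rule star_condition_mono) auto
  moreover have "\<forall>a < n. \<forall>b < n. \<forall>c < n. \<forall>d < n. \<forall>e < n.
      \<not> W4_on adj a b c d e \<and> \<not> dart_on adj a b c d e \<and> \<not> gem_on adj a b c d e"
    using free[unfolded W4_dart_gem_free_iff V] by simp
  ultimately have "verified k n adj (\<lambda>i j. d i < d j) (\<lambda>c i. \<rho> i = Suc c)"
    unfolding verified_def
  proof (intro conjI)
    show "\<forall>i < n. i \<noteq> 0 \<longrightarrow> (\<exists>j < n. d j < d i \<and> adj i j)"
      using d unfolding V by blast
    show "\<forall>i < n. \<forall>j < n. adj i j \<longrightarrow> adj j i"
      using adj_sym by blast
    show "\<forall>i < n. \<exists>c < k. \<rho> i = Suc c"
      using \<rho> by blast
  qed (use n adj_irrefl in simp_all)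
  then show ?thesis by blast
qed

section \<open>Adjacency matrices as words\<close>

lemma nth_adjacency_code:
  assumes "pverts G = {..<n}"
  shows "length (adjacency_code G) = n * n"
    and "i < n \<Longrightarrow> j < n \<Longrightarrow> adjacency_code G ! (i * n + j) \<longleftrightarrow> (i, j) \<in> parcs G"
proof -
  show "length (adjacency_code G) = n * n"
    by (simp add: adjacency_code_def assms)
  assume ij: "i < n" "j < n"
  have "i * n + j < Suc i * n" using ij by simp
  also have "\<dots> \<le> n * n" using ij by (intro mult_le_mono) auto
  finally have "i * n + j < n * n" .
  then show "adjacency_code G ! (i * n + j) \<longleftrightarrow> (i, j) \<in> parcs G"
    using ij by (simp add: adjacency_code_def assms product_nth)
qed

text \<open>Every word of square length is the matrix of a digraph, position \<open>p\<close> being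
  in row \<open>p div n\<close> and column \<open>p mod n\<close>. It is \<open>verified\<close>
  that makes this digraph a simple graph.\<close>

lemma adjacency_code_graph_of:
  assumes "length x = n * n"
  shows "adjacency_code (graph_of n (\<lambda>i j. x ! (i * n + j))) = x"
proof (rule nth_equalityI)
  let ?G = "graph_of n (\<lambda>i j. x ! (i * n + j))"
  have V: "pverts ?G = {..<n}" by (simp add: graph_of_def)
  show "length (adjacency_code ?G) = length x"
    using nth_adjacency_code(1)[OF V] assms by simp
  fix p assume "p < length (adjacency_code ?G)"
  then have p: "p < n * n" using nth_adjacency_code(1)[OF V] by simp
  then have "0 < n" by (cases n) auto
  then have "p div n < n" "p mod n < n"
    using p by (auto simp: less_mult_imp_div_less)
  from nth_adjacency_code(2)[OF V this] show "adjacency_code ?G ! p = x ! p"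
    using \<open>p div n < n\<close> \<open>p mod n < n\<close> by (simp add: graph_of_def)
qed

lemma STAR_COLORING_iff:
  "x \<in> STAR_COLORING k W4_dart_gem_free \<longleftrightarrow>
    (\<exists>n prec col. length x = n * n \<and> verified k n (\<lambda>i j. x ! (i * n + j)) prec col)"
proof
  assume "x \<in> STAR_COLORING k W4_dart_gem_free"
  then obtain G n \<rho> where x: "x = adjacency_code G" and G: "pair_graph G" "pverts G = {..<n}"
      "Digraph_Component.connected (with_proj G)" "W4_dart_gem_free (with_proj G)"
      "is_star_coloring k (with_proj G) \<rho>"
    unfolding STAR_COLORING_def by blast
  obtain prec col where "verified k n (\<lambda>i j. (i, j) \<in> parcs G) prec col"
    using verified_complete[OF G] by blast
  then have "verified k n (\<lambda>i j. x ! (i * n + j)) prec col"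
    by (rule verified_cong[rotated 3]) (simp_all add: x nth_adjacency_code(2)[OF G(2)])
  then show "\<exists>n prec col. length x = n * n \<and> verified k n (\<lambda>i j. x ! (i * n + j)) prec col"
    using nth_adjacency_code(1)[OF G(2)] x by blast
next
  assume "\<exists>n prec col. length x = n * n \<and> verified k n (\<lambda>i j. x ! (i * n + j)) prec col"
  then obtain n prec col where len: "length x = n * n"
      and ver: "verified k n (\<lambda>i j. x ! (i * n + j)) prec col"
    by blast
  show "x \<in> STAR_COLORING k W4_dart_gem_free"
    unfolding STAR_COLORING_def
    using verified_sound[OF ver] adjacency_code_graph_of[OF len, symmetric]
    by (auto simp: graph_of_def)
qed

subsection \<open>The verifier as a formula\<close>

definition Imp :: "fm \<Rightarrow> fm \<Rightarrow> fm" where "Imp \<phi> \<psi> = Neg (And \<phi> (Neg \<psi>))"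
definition Iff :: "fm \<Rightarrow> fm \<Rightarrow> fm" where "Iff \<phi> \<psi> = And (Imp \<phi> \<psi>) (Imp \<psi> \<phi>)"
definition All :: "nat \<Rightarrow> trm \<Rightarrow> fm \<Rightarrow> fm" where "All x a \<phi> = Neg (Ex x a (Neg \<phi>))"
definition Eq :: "nat \<Rightarrow> nat \<Rightarrow> fm" where
  "Eq x y = And (Neg (Less (Var x) (Var y))) (Neg (Less (Var y) (Var x)))"

lemma sat_connectives [simp]:
  "sat w e (Imp \<phi> \<psi>) \<longleftrightarrow> (sat w e \<phi> \<longrightarrow> sat w e \<psi>)"
  "sat w e (Iff \<phi> \<psi>) \<longleftrightarrow> (sat w e \<phi> \<longleftrightarrow> sat w e \<psi>)"
  "sat w e (All x a \<phi>) \<longleftrightarrow> (\<forall>v < tval w e a. sat w (e(x := v)) \<phi>)"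
  "sat w e (Eq x y) \<longleftrightarrow> e x = e y"
  by (auto simp: Imp_def Iff_def All_def Eq_def)

fun Conj :: "fm list \<Rightarrow> fm" where
  "Conj [] = Less (Num 0) (Num 1)"
| "Conj (\<phi> # \<phi>s) = And \<phi> (Conj \<phi>s)"

lemma sat_Conj [simp]: "sat w e (Conj \<phi>s) \<longleftrightarrow> (\<forall>\<phi> \<in> set \<phi>s. sat w e \<phi>)"
  by (induction \<phi>s) auto

definition bit_at :: "bool list \<Rightarrow> nat \<Rightarrow> bool" where
  "bit_at w p \<longleftrightarrow> p < length w \<and> w ! p"

text \<open>
  Variable 0 holds the number \<open>n\<close> of vertices. On input \<open>word_pair x u\<close> the bits of \<open>x\<close> are at the
  even positions below \<open>2n\<^sup>2\<close>, and \<open>u\<close> starts at \<open>2n\<^sup>2 + 2\<close> with an \<open>n \<times> n\<close> matrix for the order,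
  followed by a \<open>k \<times> n\<close> matrix for the colours.
\<close>

definition edge_bit :: "bool list \<Rightarrow> nat \<Rightarrow> nat \<Rightarrow> nat \<Rightarrow> bool" where
  "edge_bit w n i j \<longleftrightarrow> bit_at w (2 * (i * n + j))"

definition prec_bit :: "bool list \<Rightarrow> nat \<Rightarrow> nat \<Rightarrow> nat \<Rightarrow> bool" where
  "prec_bit w n i j \<longleftrightarrow> bit_at w (2 * (n * n) + 2 + (i * n + j))"

definition col_bit :: "bool list \<Rightarrow> nat \<Rightarrow> nat \<Rightarrow> nat \<Rightarrow> bool" where
  "col_bit w n c i \<longleftrightarrow> bit_at w (2 * (n * n) + 2 + (n * n + (c * n + i)))"

abbreviation n_fm :: trm where "n_fm \<equiv> Var 0"

abbreviation cert_fm :: trm where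
  "cert_fm \<equiv> Add (Mul (Num 2) (Mul n_fm n_fm)) (Num 2)"

definition edge_fm :: "nat \<Rightarrow> nat \<Rightarrow> fm" where
  "edge_fm i j = Bit (Mul (Num 2) (Add (Mul (Var i) n_fm) (Var j)))"

definition prec_fm :: "nat \<Rightarrow> nat \<Rightarrow> fm" where
  "prec_fm i j = Bit (Add cert_fm (Add (Mul (Var i) n_fm) (Var j)))"

definition col_fm :: "nat \<Rightarrow> nat \<Rightarrow> fm" where
  "col_fm c i = Bit (Add cert_fm (Add (Mul n_fm n_fm) (Add (Mul (Var c) n_fm) (Var i))))"

lemma sat_bits [simp]:
  "sat w e (edge_fm i j) \<longleftrightarrow> edge_bit w (e 0) (e i) (e j)"
  "sat w e (prec_fm i j) \<longleftrightarrow> prec_bit w (e 0) (e i) (e j)"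
  "sat w e (col_fm i j) \<longleftrightarrow> col_bit w (e 0) (e i) (e j)"
  by (simp_all add: edge_fm_def prec_fm_def col_fm_def edge_bit_def prec_bit_def col_bit_def bit_at_def)

text \<open>Variables 1 to 5 are left to the surrounding formula and 6 is bound locally; arguments
  different from 6 avoid capture.\<close>

definition twins_fm :: "nat \<Rightarrow> nat \<Rightarrow> fm" where
  "twins_fm v w = And (edge_fm v w) (All 6 n_fm
     (Imp (And (Neg (Eq 6 v)) (Neg (Eq 6 w))) (Iff (edge_fm v 6) (edge_fm w 6))))"

definition leaf_fm :: "nat \<Rightarrow> nat \<Rightarrow> fm" where
  "leaf_fm v a = And (edge_fm v a) (Ex 6 n_fm
     (Conj [edge_fm v 6, Neg (Eq 6 a), Neg (edge_fm a 6)]))"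

definition same_fm :: "nat \<Rightarrow> nat \<Rightarrow> nat \<Rightarrow> fm" where
  "same_fm k v w = Ex 6 (Num k) (And (col_fm 6 v) (col_fm 6 w))"

lemma sat_star_parts [simp]:
  assumes "v \<noteq> 6" "w \<noteq> 6"
  shows "sat x e (twins_fm v w) \<longleftrightarrow> twins_on {..<e 0} (edge_bit x (e 0)) (e v) (e w)"
    and "sat x e (leaf_fm v w) \<longleftrightarrow> proper_leaf {..<e 0} (edge_bit x (e 0)) (e v) (e w)"
    and "sat x e (same_fm k v w) \<longleftrightarrow> (\<exists>c < k. col_bit x (e 0) c (e v) \<and> col_bit x (e 0) c (e w))"
  using assms
  by (auto simp: twins_fm_def leaf_fm_def same_fm_def twins_on_def proper_leaf_def)

definition star_fm :: "nat \<Rightarrow> fm" where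
  "star_fm k = And
     (All 1 n_fm (All 2 n_fm (Imp (twins_fm 1 2) (Neg (same_fm k 1 2)))))
     (All 1 n_fm (Imp (Ex 2 n_fm (leaf_fm 1 2))
        (Ex 2 n_fm (And (leaf_fm 1 2)
          (All 3 n_fm (Imp (And (leaf_fm 1 3) (same_fm k 1 3)) (And (Neg (Eq 3 2)) (Neg (edge_fm 3 2)))))))))"

lemma sat_star_fm [simp]:
  "sat x e (star_fm k) \<longleftrightarrow> star_condition {..<e 0} (edge_bit x (e 0))
     (\<lambda>v w. \<exists>c < k. col_bit x (e 0) c v \<and> col_bit x (e 0) c w)"
  by (simp add: star_fm_def star_condition_def Ball_def Bex_def)

definition W4_fm :: fm where
  "W4_fm = Conj ([edge_fm 1 2, edge_fm 2 3, edge_fm 3 4, edge_fm 4 1, edge_fm 5 1, edge_fm 5 2,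
     edge_fm 5 3, edge_fm 5 4, Neg (edge_fm 1 3), Neg (edge_fm 2 4), Neg (Eq 1 3), Neg (Eq 2 4)])"

definition dart_fm :: fm where
  "dart_fm = Conj ([edge_fm 1 2, edge_fm 1 3, edge_fm 1 4, edge_fm 2 3, edge_fm 2 4, edge_fm 5 1,
     Neg (edge_fm 2 5), Neg (edge_fm 3 4), Neg (edge_fm 3 5), Neg (edge_fm 4 5), Neg (Eq 3 4)])"

definition gem_fm :: fm where
  "gem_fm = Conj ([edge_fm 1 2, edge_fm 2 3, edge_fm 3 4, edge_fm 5 1, edge_fm 5 2, edge_fm 5 3,
     edge_fm 5 4, Neg (edge_fm 1 3), Neg (edge_fm 1 4), Neg (edge_fm 2 4)])"

lemma sat_patterns [simp]:
  "sat w e W4_fm \<longleftrightarrow> W4_on (edge_bit w (e 0)) (e 1) (e 2) (e 3) (e 4) (e 5)"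
  "sat w e dart_fm \<longleftrightarrow> dart_on (edge_bit w (e 0)) (e 1) (e 2) (e 3) (e 4) (e 5)"
  "sat w e gem_fm \<longleftrightarrow> gem_on (edge_bit w (e 0)) (e 1) (e 2) (e 3) (e 4) (e 5)"
  by (simp_all add: W4_fm_def dart_fm_def gem_fm_def W4_on_def dart_on_def gem_on_def)

definition verified_fm :: "nat \<Rightarrow> fm" where
  "verified_fm k = Conj [
     Less (Num 0) n_fm,
     All 1 n_fm (Neg (edge_fm 1 1)),
     All 1 n_fm (All 2 n_fm (Imp (edge_fm 1 2) (edge_fm 2 1))),
     All 1 n_fm (Neg (prec_fm 1 1)),
     All 1 n_fm (All 2 n_fm (All 3 n_fm (Imp (And (prec_fm 1 2) (prec_fm 2 3)) (prec_fm 1 3)))),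
     All 1 n_fm (Imp (Less (Num 0) (Var 1)) (Ex 2 n_fm (And (prec_fm 2 1) (edge_fm 1 2)))),
     All 1 n_fm (All 2 n_fm (All 3 n_fm (All 4 n_fm (All 5 n_fm
       (Conj [Neg W4_fm, Neg dart_fm, Neg gem_fm]))))),
     All 1 n_fm (Ex 2 (Num k) (col_fm 2 1)),
     star_fm k]"

lemma sat_verified_fm [simp]:
  "sat w e (verified_fm k) \<longleftrightarrow>
     verified k (e 0) (edge_bit w (e 0)) (prec_bit w (e 0)) (col_bit w (e 0))"
  by (simp add: verified_fm_def verified_def)

text \<open>The bits of a pair agree in the doubled part, so the separator is the first pair whose
  bits differ. Requiring it at index \<open>n * n\<close> pins down \<open>n\<close>.\<close>

definition header_fm :: fm where
  "header_fm = Conj [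
     Neg (Bit (Mul (Num 2) (Mul n_fm n_fm))),
     Bit (Add (Mul (Num 2) (Mul n_fm n_fm)) (Num 1)),
     All 1 (Mul n_fm n_fm)
       (Iff (Bit (Mul (Num 2) (Var 1))) (Bit (Add (Mul (Num 2) (Var 1)) (Num 1))))]"

text \<open>The square root \<open>n\<close> of the length is found by search; \<open>Len\<close> is
  a sufficient bound as \<open>n \<le> n * n\<close>.\<close>

definition verifier_fm :: "nat \<Rightarrow> fm" where
  "verifier_fm k = Ex 0 Len (And header_fm (verified_fm k))"

section \<open>Reading a paired word\<close>

lemma bit_at_word_pair:
  "i < length x \<Longrightarrow> bit_at (word_pair x u) (2 * i) \<longleftrightarrow> x ! i"
  "i < length x \<Longrightarrow> bit_at (word_pair x u) (2 * i + 1) \<longleftrightarrow> x ! i"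
  "\<not> bit_at (word_pair x u) (2 * length x)"
  "bit_at (word_pair x u) (2 * length x + 1)"
  "bit_at (word_pair x u) (2 * length x + 2 + p) \<longleftrightarrow> bit_at u p"
proof -
  have len: "length (concat (map (\<lambda>b. [b, b]) x)) = 2 * length x"
    by (induction x) auto
  have nth: "i < length x \<Longrightarrow> concat (map (\<lambda>b. [b, b]) x) ! (2 * i) = x ! i \<and>
      concat (map (\<lambda>b. [b, b]) x) ! (2 * i + 1) = x ! i" for i
  proof (induction x arbitrary: i)
    case (Cons b x)
    then show ?case by (cases i) auto
  qed simp
  show "i < length x \<Longrightarrow> bit_at (word_pair x u) (2 * i) \<longleftrightarrow> x ! i"
    "i < length x \<Longrightarrow> bit_at (word_pair x u) (2 * i + 1) \<longleftrightarrow> x ! i"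
    "\<not> bit_at (word_pair x u) (2 * length x)"
    "bit_at (word_pair x u) (2 * length x + 1)"
    "bit_at (word_pair x u) (2 * length x + 2 + p) \<longleftrightarrow> bit_at u p"
    using nth[of i] by (auto simp: bit_at_def word_pair_def len nth_append)
qed

lemma sat_header_fm:
  "sat (word_pair x u) e header_fm \<longleftrightarrow> length x = e 0 * e 0"
proof -
  let ?w = "word_pair x u" and ?m = "e 0 * e 0"
  have "sat ?w e header_fm \<longleftrightarrow> \<not> bit_at ?w (2 * ?m) \<and> bit_at ?w (2 * ?m + 1) \<and>
      (\<forall>i < ?m. bit_at ?w (2 * i) \<longleftrightarrow> bit_at ?w (2 * i + 1))"
    by (simp add: header_fm_def bit_at_def)
  \<comment> \<open>If \<open>?m\<close> were smaller, the pair at index \<open>?m\<close> would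
    have equal bits; if it were larger, the separator would violate the agreement of all pairs below
    \<open>?m\<close>.\<close>
  moreover have "?m = length x" if "\<not> bit_at ?w (2 * ?m)" "bit_at ?w (2 * ?m + 1)"
      "\<forall>i < ?m. bit_at ?w (2 * i) \<longleftrightarrow> bit_at ?w (2 * i + 1)"
    using that bit_at_word_pair(1,2)[of ?m x u] bit_at_word_pair(3,4)[of x u]
    by (meson linorder_neqE_nat)
  moreover have "\<not> bit_at ?w (2 * ?m) \<and> bit_at ?w (2 * ?m + 1) \<and>
      (\<forall>i < ?m. bit_at ?w (2 * i) \<longleftrightarrow> bit_at ?w (2 * i + 1))" if m: "length x = ?m"
    unfolding m[symmetric] using bit_at_word_pair(1,2)[of _ x u] bit_at_word_pair(3,4)[of x u] by blast
  ultimately show ?thesis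
    by metis
qed

lemma matrix_index_less: "i < m \<Longrightarrow> j < n \<Longrightarrow> i * n + j < m * (n::nat)"
  by (metis add.commute add_less_cancel_left less_le_trans mult.commute mult_Suc_right mult_le_mono2 Suc_leI)

lemma sat_verifier_fm:
  "sat (word_pair x u) e (verifier_fm k) \<longleftrightarrow>
    (\<exists>n. length x = n * n \<and> verified k n (\<lambda>i j. x ! (i * n + j)) (\<lambda>i j. bit_at u (i * n + j))
      (\<lambda>c i. bit_at u (n * n + (c * n + i))))"
proof -
  let ?w = "word_pair x u"
  have "length x < length ?w"
    by (simp add: word_pair_def) (induction x, auto)
  then have lt: "n < length ?w" if "length x = n * n" for n
    using that by (metis le_less_trans le_square)
  have "verified k n (edge_bit ?w n) (prec_bit ?w n) (col_bit ?w n) \<longleftrightarrow>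
      verified k n (\<lambda>i j. x ! (i * n + j)) (\<lambda>i j. bit_at u (i * n + j))
        (\<lambda>c i. bit_at u (n * n + (c * n + i)))" if len: "length x = n * n" for n
  proof -
    have "edge_bit ?w n i j \<longleftrightarrow> x ! (i * n + j)" if "i < n" "j < n" for i j
      using matrix_index_less[OF that] len bit_at_word_pair(1)[of "i * n + j" x u]
      by (simp add: edge_bit_def)
    moreover have "prec_bit ?w n i j \<longleftrightarrow> bit_at u (i * n + j)" for i j
      unfolding prec_bit_def len[symmetric] by (rule bit_at_word_pair(5))
    moreover have "col_bit ?w n i j \<longleftrightarrow> bit_at u (n * n + (i * n + j))" for i j
      unfolding col_bit_def len[symmetric] by (rule bit_at_word_pair(5))
    ultimately show ?thesis
      using verified_cong[of n "edge_bit ?w n" "\<lambda>i j. x ! (i * n + j)" "prec_bit ?w n"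
          "\<lambda>i j. bit_at u (i * n + j)" k "col_bit ?w n" "\<lambda>c i. bit_at u (n * n + (c * n + i))"]
        verified_cong[of n "\<lambda>i j. x ! (i * n + j)" "edge_bit ?w n"
          "\<lambda>i j. bit_at u (i * n + j)" "prec_bit ?w n" k "\<lambda>c i. bit_at u (n * n + (c * n + i))" "col_bit ?w n"]
      by blast
  qed
  then show ?thesis
    unfolding verifier_fm_def using lt by (auto simp: sat_header_fm)
qed

theorem theorem24:
  fixes k :: nat
  shows "STAR_COLORING k W4_dart_gem_free \<in> class_NP"
proof -
  let ?V = "{w. sat w (\<lambda>_. 0) (verifier_fm k)}"
  \<comment> \<open>The certificate has \<open>n * n + k * n\<close> bits, and
    \<open>n \<le> n * n\<close>, the length of \<open>x\<close>.\<close>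
  let ?p = "[:0, k + 1:] :: nat poly"
  have "x \<in> STAR_COLORING k W4_dart_gem_free \<longleftrightarrow>
      (\<exists>u. length u \<le> poly ?p (length x) \<and> word_pair x u \<in> ?V)" for x
  proof
    assume "x \<in> STAR_COLORING k W4_dart_gem_free"
    then obtain n prec col where len: "length x = n * n"
        and ver: "verified k n (\<lambda>i j. x ! (i * n + j)) prec col"
      unfolding STAR_COLORING_iff by blast
    \<comment> \<open>Both matrices are stored row by row, so \<open>div\<close> and
      \<open>mod\<close> recover row and column.\<close>
    define f where "f p = (if p < n * n then prec (p div n) (p mod n)
      else col ((p - n * n) div n) ((p - n * n) mod n))" for p
    define u where "u = map f [0..<n * n + k * n]"
    have bit: "bit_at u p \<longleftrightarrow> f p" if "p < n * n + k * n" for p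
      using that by (simp add: bit_at_def u_def)
    have "verified k n (\<lambda>i j. x ! (i * n + j)) (\<lambda>i j. bit_at u (i * n + j))
        (\<lambda>c i. bit_at u (n * n + (c * n + i)))"
    proof (rule verified_cong[OF _ _ _ ver])
      show "prec i j \<longleftrightarrow> bit_at u (i * n + j)" if "i < n" "j < n" for i j
        using matrix_index_less[OF that] that by (simp add: bit f_def)
      show "col c i \<longleftrightarrow> bit_at u (n * n + (c * n + i))" if "c < k" "i < n" for c i
        using matrix_index_less[OF that] that by (simp add: bit f_def)
    qed simp
    then have "word_pair x u \<in> ?V"
      using len sat_verifier_fm by blast
    moreover have "length u \<le> poly ?p (length x)"
      using len le_square[of n] by (simp add: u_def algebra_simps)
    ultimately show "\<exists>u. length u \<le> poly ?p (length x) \<and> word_pair x u \<in> ?V" by blast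
  next
    assume "\<exists>u. length u \<le> poly ?p (length x) \<and> word_pair x u \<in> ?V"
    then show "x \<in> STAR_COLORING k W4_dart_gem_free"
      unfolding STAR_COLORING_iff sat_verifier_fm mem_Collect_eq by blast
  qed
  then show ?thesis
    unfolding class_NP_def using bounded_arithmetic_in_class_P[of "verifier_fm k"] by blast
qed

end
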